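(* Assume the setting below and let $\lambda\in\mathbb C\setminus\sigma_{\mathrm{ess}}(\mathcal L)$. Suppose $\boldsymbol\psi\in C^1(\mathbb R,\mathbb R^2)$, that $\boldsymbol\psi$ and $\boldsymbol\psi_x$ decay exponentially as $|x|\to\infty$, and that $\det(\mathbf M(x))\neq0$ for all $x\in\mathbb R$. Then the kernel $\mathbf K(\cdot,\cdot;\lambda)$ is globally Lipschitz-continuous on $\mathbb R\times\mathbb R$.
   Context: Setting. Real parameters $D,\beta,\delta,\alpha,\epsilon,\gamma,\mu,\nu$ with $\beta\ge0$, $(D,\beta)\ne(0,0)$; $\mathbf B=\begin{bmatrix}\beta&-D/2\\ D/2&\beta\end{bmatrix}$, $\mathbf N_0=\begin{bmatrix}\delta&-\alpha\\ \alpha&\delta\end{bmatrix}$, $\mathbf N_1=\begin{bmatrix}\epsilon&-\gamma\\ \gamma&\epsilon\end{bmatrix}$, $\mathbf N_2=\begin{bmatrix}\mu&-\nu\\ \nu&\mu\end{bmatrix}$; $\psi$ a stationary pulse of the cubic–quintic CGLE $i\Psi_t+\frac D2\Psi_{xx}+\gamma|\Psi|^2\Psi+\nu|\Psi|^4\Psi=i\delta\Psi+i\epsilon|\Psi|^2\Psi+i\beta\Psi_{xx}+i\mu|\Psi|^4\Psi$ ($\Psi=e^{-i\alpha t}\psi(x)$), $\boldsymbol\psi=[\operatorname{Re}\psi\ \operatorname{Im}\psi]^T$, $|\boldsymbol\psi|=\|\boldsymbol\psi(x)\|_2$; $\mathbf M(x)=\mathbf N_1|\boldsymbol\psi|^2+\mathbf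 N_2|\boldsymbol\psi|^4+(2\mathbf N_1+4\mathbf N_2|\boldsymbol\psi|^2)\boldsymbol\psi\boldsymbol\psi^T$; $\mathcal L=\mathbf B\partial_x^2+\mathbf N_0+\mathbf M$, $\sigma_{\mathrm{ess}}(\mathcal L)=\{(\delta\pm i\alpha)-s^2(\beta\pm iD/2):s\in\mathbb R\}$. $\mathbf R_\ell=\begin{bmatrix}\mathbf 0&\mathbf 0\\ -\mathbf B^{-1}\mathbf M|\mathbf M|^{-1/2}&\mathbf 0\end{bmatrix}$, $\mathbf R_r=\begin{bmatrix}|\mathbf M|^{1/2}&\mathbf 0\\ \mathbf 0&\mathbf 0\end{bmatrix}$ with $|\mathbf M|=(\mathbf M^*\mathbf M)^{1/2}$. $\mathbf A_\infty(\lambda)=\begin{bmatrix}\mathbf 0&\mathbf I\\ \mathbf B^{-1}(\lambda\mathbf I-\mathbf N_0)&\mathbf 0\end{bmatrix}$, $\mathbf Q(\lambda)$ its stable spectral projection. $\mathbf K(x,y;\lambda)=-\mathbf R_r(x)\mathbf Qe^{\mathbf A_\infty(x-y)}\mathbf Q\mathbf R_\ell(y)$ for $x\ge y$, $\mathbf R_r(x)(\mathbf I-\mathbf Q)e^{\mathbf A_\infty(x-y)}(\mathbf I-\mathbf Q)\mathbf R_\ell(y)$ for $x<y$. *)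

theory Defs
  imports "HOL-Analysis.Analysis"
begin

type_synonym idx4 = "2 + 2"

definition m2 :: "'a::zero \<Rightarrow> 'a \<Rightarrow> 'a \<Rightarrow> 'a \<Rightarrow> 'a^2^2" where
  "m2 a b c d = vector [vector [a, b], vector [c, d]]"

definition blk :: "'a^2^2 \<Rightarrow> 'a^2^2 \<Rightarrow> 'a^2^2 \<Rightarrow> 'a^2^2 \<Rightarrow> 'a^idx4^idx4" where
  "blk P Q R S = (\<chi> i j. (case i of
        Inl a \<Rightarrow> (case j of Inl b \<Rightarrow> P$a$b | Inr b \<Rightarrow> Q$a$b)
      | Inr a \<Rightarrow> (case j of Inl b \<Rightarrow> R$a$b | Inr b \<Rightarrow> S$a$b)))"

definition cmat :: "real^'n^'m \<Rightarrow> complex^'n^'m" where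
  "cmat A = (\<chi> i j. complex_of_real (A$i$j))"

fun matpow :: "'a::comm_ring_1^'n::finite^'n \<Rightarrow> nat \<Rightarrow> 'a^'n^'n" where
  "matpow A 0 = mat 1"
| "matpow A (Suc k) = A ** matpow A k"

definition mexp :: "complex^'n::finite^'n \<Rightarrow> complex^'n^'n" where
  "mexp A = (\<Sum>k. inverse (fact k) *\<^sub>R matpow A k)"

definition gen_eigenspace :: "complex^'n::finite^'n \<Rightarrow> complex \<Rightarrow> (complex^'n) set" where
  "gen_eigenspace A \<mu> = {v. matpow (A - mat \<mu>) CARD('n) *v v = 0}"

definition stable_subspace :: "complex^'n::finite^'n \<Rightarrow> (complex^'n) set" where
  "stable_subspace A = span (\<Union>\<mu>\<in>{\<mu>. Re \<mu> < 0}. gen_eigenspace A \<mu>)"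

definition unstable_subspace :: "complex^'n::finite^'n \<Rightarrow> (complex^'n) set" where
  "unstable_subspace A = span (\<Union>\<mu>\<in>{\<mu>. Re \<mu> > 0}. gen_eigenspace A \<mu>)"

(* stable spectral projection: projection onto the stable generalized eigenspace
   along the unstable one (well defined for hyperbolic A) *)
definition stable_proj :: "complex^'n::finite^'n \<Rightarrow> complex^'n^'n" where
  "stable_proj A = (THE P. P ** P = P \<and> range (\<lambda>v. P *v v) = stable_subspace A
                       \<and> {v. P *v v = 0} = unstable_subspace A)"

definition psd_sqrt :: "real^'n::finite^'n \<Rightarrow> real^'n^'n" where
  "psd_sqrt S = (THE R. transpose R = R \<and> (\<forall>v. 0 \<le> v \<bullet> (R *v v)) \<and> R ** R = S)"

definition absM :: "real^'n::finite^'n \<Rightarrow> real^'n^'n" where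
  "absM M = psd_sqrt (transpose M ** M)"

definition cgl_B :: "real \<Rightarrow> real \<Rightarrow> real^2^2" where
  "cgl_B D \<beta> = m2 \<beta> (- D/2) (D/2) \<beta>"

definition rotm :: "real \<Rightarrow> real \<Rightarrow> real^2^2" where
  "rotm a b = m2 a (- b) b a"

definition vec2 :: "complex \<Rightarrow> real^2" where
  "vec2 z = vector [Re z, Im z]"

(* M(x) for the pulse value z = psi(x), with N1 = rotm eps gam, N2 = rotm mu nu *)
definition cgl_M :: "real \<Rightarrow> real \<Rightarrow> real \<Rightarrow> real \<Rightarrow> complex \<Rightarrow> real^2^2" where
  "cgl_M \<epsilon> \<gamma> \<mu> \<nu> z =
     (norm (vec2 z))\<^sup>2 *\<^sub>R rotm \<epsilon> \<gamma> + (norm (vec2 z))^4 *\<^sub>R rotm \<mu> \<nu>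
     + (2 *\<^sub>R rotm \<epsilon> \<gamma> + (4 * (norm (vec2 z))\<^sup>2) *\<^sub>R rotm \<mu> \<nu>)
       ** (\<chi> i j. vec2 z $ i * vec2 z $ j)"

definition cgl_Rr :: "real^2^2 \<Rightarrow> complex^idx4^idx4" where
  "cgl_Rr M = blk (cmat (psd_sqrt (absM M))) 0 0 0"

definition cgl_Rl :: "real^2^2 \<Rightarrow> real^2^2 \<Rightarrow> complex^idx4^idx4" where
  "cgl_Rl B M = blk 0 0 (cmat (- (matrix_inv B ** M ** matrix_inv (psd_sqrt (absM M))))) 0"

definition cgl_Ainf :: "real^2^2 \<Rightarrow> real^2^2 \<Rightarrow> complex \<Rightarrow> complex^idx4^idx4" where
  "cgl_Ainf B N0 lam = blk 0 (mat 1) (cmat (matrix_inv B) ** (mat lam - cmat N0)) 0"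

definition cgl_K ::
  "(real \<Rightarrow> complex^idx4^idx4) \<Rightarrow> (real \<Rightarrow> complex^idx4^idx4) \<Rightarrow> complex^idx4^idx4
     \<Rightarrow> real \<times> real \<Rightarrow> complex^idx4^idx4" where
  "cgl_K Rr Rl A = (\<lambda>(x, y).
     (let Q = stable_proj A; E = mexp ((x - y) *\<^sub>R A) in
      if y \<le> x then - (Rr x ** Q ** E ** Q ** Rl y)
      else Rr x ** (mat 1 - Q) ** E ** (mat 1 - Q) ** Rl y))"

definition ess_spec :: "real \<Rightarrow> real \<Rightarrow> real \<Rightarrow> real \<Rightarrow> complex set" where
  "ess_spec D \<beta> \<delta> \<alpha> =
     {z. \<exists>s::real. z = Complex \<delta> \<alpha> - of_real (s\<^sup>2) * Complex \<beta> (D/2)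
              \<or> z = Complex \<delta> (- \<alpha>) - of_real (s\<^sup>2) * Complex \<beta> (- D/2)}"

end

theory Submission
  imports Defs
begin

text \<open>Write \<open>M = \<rho>\<^sup>2 G\<close> with \<open>\<rho> = |\<psi>|\<close> if \<open>N\<^sub>1 \<noteq> 0\<close> and \<open>\<rho> = |\<psi>|\<^sup>2\<close> if \<open>N\<^sub>1 = 0\<close>. Then \<open>det G\<close> is
  bounded away from zero, because it is continuous, vanishes nowhere and has a nonzero limit at infinity.
  Although \<open>G\<close> depends on the direction \<open>\<psi> / |\<psi>|\<close>, which need not be Lipschitz, \<open>\<rho>\<close> times an increment of
  \<open>G\<close> is controlled, and this property is stable under algebraic operations; hence \<open>|M|\<^sup>1\<^sup>/\<^sup>2\<close> and
  \<open>M |M|\<^sup>-\<^sup>1\<^sup>/\<^sup>2\<close>, both of the form \<open>\<rho>\<close> times an algebraic function of \<open>G\<close>, are Lipschitz. Off the essential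
  spectrum \<open>A\<^sub>\<infinity>\<close> is diagonalisable without purely imaginary eigenvalues, so both branches of the Green's function
  are bounded and Lipschitz, and its jump on the diagonal is killed by \<open>R\<^sub>r R\<^sub>\<ell> = 0\<close>.\<close>

section \<open>Lipschitz functions up to a weight\<close>

text \<open>The weight stands at \<open>x\<close> only; by symmetry the bound also holds with
  \<open>\<rho> y\<close>. Increments may be large where the weight is small, which accommodates the
  direction of psi. Boundedness is included so that the class is closed under products.\<close>

definition weighted_lipschitz ::
    "('m::metric_space \<Rightarrow> real) \<Rightarrow> ('m \<Rightarrow> 'a::real_normed_vector) \<Rightarrow> bool" where
  "weighted_lipschitz \<rho> f \<longleftrightarrow> bounded (range f) \<and>
     (\<exists>L. \<forall>x y. \<rho> x * norm (f x - f y) \<le> L * dist x y)"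

lemma weighted_lipschitzI:
  assumes "\<And>x. norm (f x) \<le> b" and "\<And>x y. \<rho> x * norm (f x - f y) \<le> L * dist x y"
  shows "weighted_lipschitz \<rho> f"
  using assms unfolding weighted_lipschitz_def bounded_iff by blast

lemma weighted_lipschitzE:
  assumes "weighted_lipschitz \<rho> f"
  obtains b L where "b > 0" "\<And>x. norm (f x) \<le> b"
    "L > 0" "\<And>x y. \<rho> x * norm (f x - f y) \<le> L * dist x y"
proof -
  obtain b L where b: "b > 0" "\<And>x. norm (f x) \<le> b"
    and L: "\<And>x y. \<rho> x * norm (f x - f y) \<le> L * dist x y"
    using assms unfolding weighted_lipschitz_def bounded_pos by blast
  have "\<rho> x * norm (f x - f y) \<le> max L 1 * dist x y" for x y
    using L[of x y] mult_right_mono[OF max.cobounded1[of L 1] zero_le_dist[of x y]] by linarith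
  then show thesis
    using that[of b "max L 1"] b by simp
qed

lemma weighted_lipschitz_const [simp]: "weighted_lipschitz \<rho> (\<lambda>_. c)"
  by (rule weighted_lipschitzI[of _ "norm c" _ 0]) auto

text \<open>Serves compositions with an outer function that need only be Lipschitz on the range of
  \<open>f\<close>, such as roots and reciprocals away from zero.\<close>

lemma weighted_lipschitz_dominated:
  assumes f: "weighted_lipschitz \<rho> f" and "\<And>x. 0 \<le> \<rho> x"
    and bd: "\<And>x. norm (g x) \<le> b"
    and le: "\<And>x y. norm (g x - g y) \<le> c * norm (f x - f y)" and c: "0 \<le> c"
  shows "weighted_lipschitz \<rho> g"
proof -
  obtain L where L: "L > 0" "\<And>x y. \<rho> x * norm (f x - f y) \<le> L * dist x y"
    using weighted_lipschitzE[OF f] by metis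
  show ?thesis
  proof (rule weighted_lipschitzI[OF bd])
    fix x y
    have "\<rho> x * norm (g x - g y) \<le> c * (\<rho> x * norm (f x - f y))"
      using mult_left_mono[OF le assms(2)[of x]] by (simp add: mult_ac)
    also have "\<dots> \<le> c * (L * dist x y)"
      by (intro mult_left_mono L c)
    finally show "\<rho> x * norm (g x - g y) \<le> (c * L) * dist x y"
      by (simp add: mult_ac)
  qed
qed

context
  fixes \<rho> :: "'m::metric_space \<Rightarrow> real"
  assumes weight_nonneg: "\<And>x. 0 \<le> \<rho> x"
begin

text \<open>One factor is changed at a time: the weight is spent on the single increment, and the
  other factor is bounded.\<close>

lemma weighted_lipschitz_bilinear:
  assumes h: "bounded_bilinear h" and f: "weighted_lipschitz \<rho> f" and g: "weighted_lipschitz \<rho> g"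
  shows "weighted_lipschitz \<rho> (\<lambda>x. h (f x) (g x))"
proof -
  obtain bf Lf where F: "bf > 0" "\<And>x. norm (f x) \<le> bf" "Lf > 0"
      "\<And>x y. \<rho> x * norm (f x - f y) \<le> Lf * dist x y"
    using weighted_lipschitzE[OF f] by metis
  obtain bg Lg where G: "bg > 0" "\<And>x. norm (g x) \<le> bg" "Lg > 0"
      "\<And>x y. \<rho> x * norm (g x - g y) \<le> Lg * dist x y"
    using weighted_lipschitzE[OF g] by metis
  obtain K where K: "K > 0" "\<And>a b. norm (h a b) \<le> norm a * norm b * K"
    using bounded_bilinear.pos_bounded[OF h] by blast
  show ?thesis
  proof (rule weighted_lipschitzI)
    fix x
    show "norm (h (f x) (g x)) \<le> bf * bg * K"
      by (rule order_trans[OF K(2)]) (intro mult_mono F G; use F G K in simp)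
  next
    fix x y
    have "h (f x) (g x) - h (f y) (g y) = h (f x) (g x - g y) + h (f x - f y) (g y)"
      by (simp add: bounded_bilinear.diff_left[OF h] bounded_bilinear.diff_right[OF h])
    then have "norm (h (f x) (g x) - h (f y) (g y))
        \<le> norm (f x) * norm (g x - g y) * K + norm (f x - f y) * norm (g y) * K"
      by (metis K(2) add_mono norm_triangle_le)
    also have "\<dots> \<le> bf * norm (g x - g y) * K + norm (f x - f y) * bg * K"
      by (intro add_mono mult_right_mono mult_left_mono F G) (use K in auto)
    finally have "\<rho> x * norm (h (f x) (g x) - h (f y) (g y))
        \<le> bf * K * (\<rho> x * norm (g x - g y)) + bg * K * (\<rho> x * norm (f x - f y))"
      using mult_left_mono[OF _ weight_nonneg[of x]] by (fastforce simp: algebra_simps)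
    also have "\<dots> \<le> bf * K * (Lg * dist x y) + bg * K * (Lf * dist x y)"
      by (intro add_mono mult_left_mono F G) (use F G K in simp_all)
    finally show "\<rho> x * norm (h (f x) (g x) - h (f y) (g y))
        \<le> (bf * K * Lg + bg * K * Lf) * dist x y"
      by (simp add: algebra_simps)
  qed
qed

lemma weighted_lipschitz_linear:
  assumes h: "bounded_linear h" and f: "weighted_lipschitz \<rho> f"
  shows "weighted_lipschitz \<rho> (\<lambda>x. h (f x))"
proof -
  obtain K where K: "K > 0" "\<And>a. norm (h a) \<le> norm a * K"
    using bounded_linear.pos_bounded[OF h] by blast
  obtain b where b: "\<And>x. norm (f x) \<le> b"
    using weighted_lipschitzE[OF f] by metis
  have "norm (h (f x)) \<le> b * K" for x
    using K(2)[of "f x"] mult_right_mono[OF b[of x], of K] K(1) by linarith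
  moreover have "norm (h (f x) - h (f y)) \<le> K * norm (f x - f y)" for x y
    using K(2)[of "f x - f y"] by (simp add: linear_diff[OF bounded_linear.linear[OF h]] mult_ac)
  ultimately show ?thesis
    using weighted_lipschitz_dominated[OF f weight_nonneg] K(1) by (metis less_imp_le)
qed

lemma weighted_lipschitz_add:
  assumes "weighted_lipschitz \<rho> f" "weighted_lipschitz \<rho> g"
  shows "weighted_lipschitz \<rho> (\<lambda>x. f x + g x)"
proof -
  obtain bf Lf where F: "\<And>x. norm (f x) \<le> bf"
      "\<And>x y. \<rho> x * norm (f x - f y) \<le> Lf * dist x y"
    using weighted_lipschitzE[OF assms(1)] by metis
  obtain bg Lg where G: "\<And>x. norm (g x) \<le> bg"
      "\<And>x y. \<rho> x * norm (g x - g y) \<le> Lg * dist x y"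
    using weighted_lipschitzE[OF assms(2)] by metis
  show ?thesis
  proof (rule weighted_lipschitzI)
    show "norm (f x + g x) \<le> bf + bg" for x
      using F(1) G(1) by (rule norm_add_rule_thm)
    fix x y
    have "\<rho> x * norm (f x + g x - (f y + g y)) \<le> \<rho> x * (norm (f x - f y) + norm (g x - g y))"
      by (intro mult_left_mono weight_nonneg) (metis add_diff_add norm_triangle_ineq)
    then show "\<rho> x * norm (f x + g x - (f y + g y)) \<le> (Lf + Lg) * dist x y"
      using F(2)[of x y] G(2)[of x y] by (simp add: algebra_simps)
  qed
qed

lemma weighted_lipschitz_minus:
  "weighted_lipschitz \<rho> f \<Longrightarrow> weighted_lipschitz \<rho> (\<lambda>x. - f x)"
  by (rule weighted_lipschitz_linear) (rule bounded_linear_minus[OF bounded_linear_ident])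

lemma weighted_lipschitz_diff:
  assumes "weighted_lipschitz \<rho> f" "weighted_lipschitz \<rho> g"
  shows "weighted_lipschitz \<rho> (\<lambda>x. f x - g x)"
  using weighted_lipschitz_add[OF assms(1) weighted_lipschitz_minus[OF assms(2)]] by simp

lemma weighted_lipschitz_sum:
  assumes "\<And>i. i \<in> I \<Longrightarrow> weighted_lipschitz \<rho> (f i)"
  shows "weighted_lipschitz \<rho> (\<lambda>x. \<Sum>i\<in>I. f i x)"
  using assms by (induction I rule: infinite_finite_induct) (auto intro: weighted_lipschitz_add)

lemma weighted_lipschitz_vec:
  assumes "\<And>i. weighted_lipschitz \<rho> (\<lambda>x. f x $ i)"
  shows "weighted_lipschitz \<rho> f"
proof -
  have "\<exists>b L. (\<forall>x. norm (f x $ i) \<le> b) \<and> (\<forall>x y. \<rho> x * norm (f x $ i - f y $ i) \<le> L * dist x y)" for i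
    using weighted_lipschitzE[OF assms[of i]] by metis
  then obtain b L where bL: "\<And>i x. norm (f x $ i) \<le> b i"
      "\<And>i x y. \<rho> x * norm (f x $ i - f y $ i) \<le> L i * dist x y"
    by metis
  have le: "norm v \<le> (\<Sum>i\<in>UNIV. norm (v $ i))" for v :: "'b^'c"
    unfolding norm_vec_def by (rule L2_set_le_sum) simp
  show ?thesis
  proof (rule weighted_lipschitzI)
    show "norm (f x) \<le> (\<Sum>i\<in>UNIV. b i)" for x
      by (rule order_trans[OF le]) (intro sum_mono bL)
    fix x y
    have "\<rho> x * norm (f x - f y) \<le> \<rho> x * (\<Sum>i\<in>UNIV. norm ((f x - f y) $ i))"
      by (intro mult_left_mono le weight_nonneg)
    also have "\<dots> \<le> (\<Sum>i\<in>UNIV. L i * dist x y)"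
      unfolding sum_distrib_left by (intro sum_mono) (use bL(2) in simp)
    finally show "\<rho> x * norm (f x - f y) \<le> (\<Sum>i\<in>UNIV. L i) * dist x y"
      by (simp add: sum_distrib_right)
  qed
qed

lemmas weighted_lipschitz_nth = weighted_lipschitz_linear[OF bounded_linear_vec_nth]
lemmas weighted_lipschitz_scaleR = weighted_lipschitz_bilinear[OF bounded_bilinear_scaleR]
lemmas weighted_lipschitz_mult = weighted_lipschitz_bilinear[OF bounded_bilinear_mult]

lemma weighted_lipschitz_power:
  fixes f :: "'m \<Rightarrow> 'a::real_normed_algebra_1"
  shows "weighted_lipschitz \<rho> f \<Longrightarrow> weighted_lipschitz \<rho> (\<lambda>x. f x ^ n)"
  by (induction n) (auto intro: weighted_lipschitz_mult)

text \<open>Multiplying the increment by the sum of the two roots gives \<open>f x - f y\<close>,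
  and that sum is at least \<open>sqrt c\<close>.\<close>

lemma weighted_lipschitz_sqrt:
  fixes f :: "'m \<Rightarrow> real"
  assumes f: "weighted_lipschitz \<rho> f" and c: "0 < c" "\<And>x. c \<le> f x"
  shows "weighted_lipschitz \<rho> (\<lambda>x. sqrt (f x))"
proof -
  obtain b where b: "\<And>x. norm (f x) \<le> b"
    using weighted_lipschitzE[OF f] by metis
  have pos: "f x > 0" "sqrt (f x) \<ge> sqrt c" for x
    using c(1) c(2)[of x] by auto
  show ?thesis
  proof (rule weighted_lipschitz_dominated[OF f weight_nonneg])
    show "norm (sqrt (f x)) \<le> sqrt b" for x
      using b[of x] pos[of x] by simp
    fix x y
    have "sqrt c * norm (sqrt (f x) - sqrt (f y))
        \<le> (sqrt (f x) + sqrt (f y)) * norm (sqrt (f x) - sqrt (f y))"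
      using pos(2)[of x] pos(1)[of y] by (intro mult_right_mono) (auto intro: add_increasing2)
    also have "\<dots> = norm ((sqrt (f x) + sqrt (f y)) * (sqrt (f x) - sqrt (f y)))"
      using pos(1)[of x] pos(1)[of y] by (simp add: abs_mult)
    also have "(sqrt (f x) + sqrt (f y)) * (sqrt (f x) - sqrt (f y)) = f x - f y"
      using pos(1)[of x] pos(1)[of y] by (simp add: algebra_simps)
    finally show "norm (sqrt (f x) - sqrt (f y)) \<le> 1 / sqrt c * norm (f x - f y)"
      using c(1) by (simp add: field_simps)
  qed (use c in auto)
qed

lemma weighted_lipschitz_inverse:
  fixes f :: "'m \<Rightarrow> real"
  assumes f: "weighted_lipschitz \<rho> f" and c: "0 < c" "\<And>x. c \<le> \<bar>f x\<bar>"
  shows "weighted_lipschitz \<rho> (\<lambda>x. inverse (f x))"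
proof (rule weighted_lipschitz_dominated[OF f weight_nonneg])
  have nz: "f x \<noteq> 0" for x
    using c(1) c(2)[of x] by auto
  have inv_le: "norm (inverse (f x)) \<le> inverse c" for x
    using c(1) c(2)[of x] by (simp add: le_imp_inverse_le)
  show "norm (inverse (f x)) \<le> inverse c" for x
    by (rule inv_le)
  fix x y
  have "inverse (f x) - inverse (f y) = - inverse (f x) * inverse (f y) * (f x - f y)"
    using nz[of x] nz[of y] by (simp add: field_simps)
  then have "norm (inverse (f x) - inverse (f y))
      = norm (inverse (f x)) * norm (inverse (f y)) * norm (f x - f y)"
    by (simp add: abs_mult)
  also have "\<dots> \<le> inverse c * inverse c * norm (f x - f y)"
    by (intro mult_right_mono mult_mono inv_le) (use c in auto)
  finally show "norm (inverse (f x) - inverse (f y))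
      \<le> inverse c * inverse c * norm (f x - f y)" .
qed (use c in auto)

lemma weighted_lipschitz_divide:
  fixes f g :: "'m \<Rightarrow> real"
  assumes "weighted_lipschitz \<rho> f" "weighted_lipschitz \<rho> g" "0 < c" "\<And>x. c \<le> \<bar>g x\<bar>"
  shows "weighted_lipschitz \<rho> (\<lambda>x. f x / g x)"
  unfolding divide_inverse
  by (intro weighted_lipschitz_mult weighted_lipschitz_inverse[of g c] assms)

end

text \<open>A smaller weight, up to a constant, demands less. Used below to descend from weight 1 to
  the modulus of psi, and from there to its square.\<close>

lemma weighted_lipschitz_weight_mono:
  assumes f: "weighted_lipschitz \<rho> f" and "\<And>x. 0 \<le> \<rho> x" "\<And>x. 0 \<le> \<sigma> x" "\<And>x. \<sigma> x \<le> c * \<rho> x"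
  shows "weighted_lipschitz \<sigma> f"
proof -
  obtain b L where F: "\<And>x. norm (f x) \<le> b" "L > 0"
      "\<And>x y. \<rho> x * norm (f x - f y) \<le> L * dist x y"
    using weighted_lipschitzE[OF f] by metis
  show ?thesis
  proof (rule weighted_lipschitzI[OF F(1)])
    fix x y
    \<comment> \<open>The sign of \<open>c\<close> is not prescribed, but the bound on
      \<open>f\<close> must be multiplied by a nonnegative constant.\<close>
    have "\<sigma> x \<le> max c 0 * \<rho> x"
      using assms(4)[of x] mult_right_mono[OF max.cobounded1[of c 0] assms(2)[of x]] by linarith
    then have "\<sigma> x * norm (f x - f y) \<le> max c 0 * (\<rho> x * norm (f x - f y))"
      by (metis mult.assoc mult_right_mono norm_ge_zero)
    also have "\<dots> \<le> max c 0 * (L * dist x y)"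
      by (intro mult_left_mono F) auto
    finally show "\<sigma> x * norm (f x - f y) \<le> (max c 0 * L) * dist x y"
      by (simp add: mult_ac)
  qed
qed

abbreviation bounded_lipschitz :: "('m::metric_space \<Rightarrow> 'a::real_normed_vector) \<Rightarrow> bool" where
  "bounded_lipschitz \<equiv> weighted_lipschitz (\<lambda>_. 1)"

lemma bounded_lipschitz_imp_lipschitz:
  assumes "bounded_lipschitz f"
  shows "\<exists>L. L-lipschitz_on UNIV f"
proof -
  obtain L where "L > 0" "\<And>x y. 1 * norm (f x - f y) \<le> L * dist x y"
    using weighted_lipschitzE[OF assms] by metis
  then show ?thesis
    by (intro exI[of _ L] lipschitz_onI) (auto simp: dist_norm)
qed

lemma bounded_lipschitz_compose:
  assumes f: "bounded_lipschitz f" and g: "L-lipschitz_on UNIV g"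
  shows "bounded_lipschitz (\<lambda>x. f (g x))"
proof -
  obtain b K where F: "\<And>x. norm (f x) \<le> b" "K > 0"
      "\<And>x y. 1 * norm (f x - f y) \<le> K * dist x y"
    using weighted_lipschitzE[OF f] by metis
  show ?thesis
  proof (rule weighted_lipschitzI)
    show "norm (f (g x)) \<le> b" for x
      by (rule F)
    fix x y
    have "K * dist (g x) (g y) \<le> K * (L * dist x y)"
      using lipschitz_onD[OF g] F(2) by (intro mult_left_mono) auto
    then show "1 * norm (f (g x) - f (g y)) \<le> (K * L) * dist x y"
      using F(3)[of "g x" "g y"] by (simp add: mult_ac)
  qed
qed

text \<open>In the product, the increment of \<open>f\<close> comes with the factor
  \<open>\<rho> x\<close>, which is exactly what the weighted bound controls. Thus a rapidly varying
  \<open>f\<close> becomes a genuinely Lipschitz function.\<close>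

lemma weighted_lipschitz_times_weight:
  assumes f: "weighted_lipschitz \<rho> f" and r: "bounded_lipschitz \<rho>" and "\<And>x. 0 \<le> \<rho> x"
  shows "bounded_lipschitz (\<lambda>x. \<rho> x *\<^sub>R f x)"
proof -
  obtain b L where F: "b > 0" "\<And>x. norm (f x) \<le> b"
      "\<And>x y. \<rho> x * norm (f x - f y) \<le> L * dist x y"
    using weighted_lipschitzE[OF f] by metis
  obtain c K where R: "c > 0" "\<And>x. norm (\<rho> x) \<le> c"
      "\<And>x y. 1 * norm (\<rho> x - \<rho> y) \<le> K * dist x y"
    using weighted_lipschitzE[OF r] by metis
  show ?thesis
  proof (rule weighted_lipschitzI)
    show "norm (\<rho> x *\<^sub>R f x) \<le> c * b" for x
      unfolding norm_scaleR using F R by (intro mult_mono) auto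
    fix x y
    have "\<rho> x *\<^sub>R f x - \<rho> y *\<^sub>R f y = (\<rho> x - \<rho> y) *\<^sub>R f y + \<rho> x *\<^sub>R (f x - f y)"
      by (simp add: algebra_simps)
    then have "norm (\<rho> x *\<^sub>R f x - \<rho> y *\<^sub>R f y)
        \<le> norm (\<rho> x - \<rho> y) * norm (f y) + \<rho> x * norm (f x - f y)"
      using assms(3)[of x] by (metis abs_of_nonneg norm_scaleR norm_triangle_ineq real_norm_def)
    also have "norm (\<rho> x - \<rho> y) * norm (f y) \<le> (K * dist x y) * b"
      using R(3)[of x y] F(1,2) order_trans[OF abs_ge_zero R(3)[of x y, simplified]]
      by (intro mult_mono) auto
    finally show "1 * norm (\<rho> x *\<^sub>R f x - \<rho> y *\<^sub>R f y) \<le> (K * b + L) * dist x y"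
      using F(3)[of x y] by (simp add: algebra_simps)
  qed
qed

section \<open>Square roots of positive definite 2x2 matrices\<close>

lemmas matrix_2_simps = vec_eq_iff forall_2 matrix_matrix_mult_def sum_2 mat_def transpose_def

lemma trace_2: "trace (A :: 'a::semiring_1^2^2) = A$1$1 + A$2$2"
  by (simp add: trace_def sum_2)

lemma cayley_hamilton_2:
  fixes A :: "'a::comm_ring_1^2^2"
  shows "A ** A + mat (det A) = mat (trace A) ** A"
  by (simp add: matrix_2_simps det_2 trace_2 algebra_simps)

lemma trace_scaleR: "trace (c *\<^sub>R A) = c * trace A" for A :: "real^'n^'n"
  by (simp add: trace_def sum_distrib_left)

lemma det_scaleR_2: "det (c *\<^sub>R A) = c\<^sup>2 * det A" for A :: "real^2^2"
  by (simp add: det_2 power2_eq_square algebra_simps)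

lemma quadratic_form_2:
  fixes R :: "real^2^2"
  shows "v \<bullet> (R *v v) = R$1$1 * (v$1)\<^sup>2 + (R$1$2 + R$2$1) * (v$1 * v$2) + R$2$2 * (v$2)\<^sup>2"
  by (simp add: inner_vec_def matrix_vector_mult_def sum_2 power2_eq_square algebra_simps)

lemma symmetric_2: "transpose R = R \<longleftrightarrow> R$1$2 = R$2$1" for R :: "'a^2^2"
  by (auto simp: matrix_2_simps)

lemma psd_2:
  fixes R :: "real^2^2"
  assumes R: "transpose R = R" "\<And>v. 0 \<le> v \<bullet> (R *v v)"
  shows "0 \<le> R$1$1" "0 \<le> R$2$2" "0 \<le> det R"
proof -
  show 1: "0 \<le> R$1$1"
    using R(2)[of "vector [1, 0]"] by (simp add: quadratic_form_2)
  show 2: "0 \<le> R$2$2"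
    using R(2)[of "vector [0, 1]"] by (simp add: quadratic_form_2)
  have sym: "R$1$2 = R$2$1"
    using R(1) by (simp add: symmetric_2)
  \<comment> \<open>The test vectors here and in the next claim are the columns of the adjugate:
    \<open>R\<close> maps them to \<open>det R\<close> times a unit vector, so the form equals a
    diagonal entry times \<open>det R\<close>.\<close>
  have "0 \<le> R$2$2 * det R"
    using R(2)[of "vector [R$2$2, - R$1$2]"]
    by (simp add: quadratic_form_2 det_2 sym power2_eq_square algebra_simps)
  moreover have "0 \<le> R$1$1 * det R"
    using R(2)[of "vector [- R$1$2, R$1$1]"]
    by (simp add: quadratic_form_2 det_2 sym power2_eq_square algebra_simps)
  \<comment> \<open>With a zero diagonal the two inequalities above are void. The form at this
    vector is then -2 times the square of \<open>R$1$2\<close>.\<close>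
  moreover have "R$1$2 = 0" if "R$1$1 = 0" "R$2$2 = 0"
    using R(2)[of "vector [1, - R$1$2]"] that
    by (auto simp: quadratic_form_2 sym mult_le_0_iff)
  ultimately show "0 \<le> det R"
    using 1 2 by (cases "R$1$1 = 0 \<and> R$2$2 = 0") (auto simp: det_2 sym zero_le_mult_iff)
qed

text \<open>Cayley-Hamilton tested against \<open>v\<close>: the trace times the form is |S v|^2 +
  det S |v|^2.\<close>

lemma psd_2I:
  fixes S :: "real^2^2"
  assumes sym: "transpose S = S" and S: "0 < trace S" "0 \<le> det S"
  shows "0 \<le> v \<bullet> (S *v v)"
proof -
  have sym': "S$1$2 = S$2$1"
    using sym by (simp add: symmetric_2)
  have d: "(S$1$2)\<^sup>2 \<le> S$1$1 * S$2$2"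
    using S(2) by (simp add: det_2 sym' power2_eq_square)
  then have "0 \<le> S$1$1 * S$2$2"
    using zero_le_power2 order_trans by blast
  then have pos: "0 \<le> S$1$1" "0 \<le> S$2$2"
    using S(1) by (auto simp: zero_le_mult_iff trace_2)
  have "trace S * (v \<bullet> (S *v v)) = (S$1$1 * v$1 + S$1$2 * v$2)\<^sup>2 + (S$1$2 * v$1 + S$2$2 * v$2)\<^sup>2
      + det S * ((v$1)\<^sup>2 + (v$2)\<^sup>2)"
    by (simp add: quadratic_form_2 trace_2 det_2 sym' power2_eq_square algebra_simps)
  also have "\<dots> \<ge> 0"
    using S(2) by simp
  finally show ?thesis
    using S(1) by (simp add: zero_le_mult_iff)
qed

text \<open>By Cayley--Hamilton a root \<open>R\<close> of \<open>S\<close> satisfies \<open>tr R \<cdot> R = S + det R \<cdot> I\<close>, where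
  \<open>det R = sqrt (det S)\<close> and \<open>(tr R)\<^sup>2 = tr S + 2 det R\<close>.\<close>

definition sqrt_2 :: "real^2^2 \<Rightarrow> real^2^2" where
  "sqrt_2 S = (1 / sqrt (trace S + 2 * sqrt (det S))) *\<^sub>R (S + mat (sqrt (det S)))"

context
  fixes S :: "real^2^2"
  assumes trace_pos: "0 < trace S" and det_nonneg: "0 \<le> det S"
begin

lemma sqrt_2_denominator_pos: "0 < sqrt (trace S + 2 * sqrt (det S))"
  using trace_pos det_nonneg by (simp add: add_pos_nonneg)

lemma trace_sqrt_2: "trace (sqrt_2 S) = sqrt (trace S + 2 * sqrt (det S))"
proof -
  let ?t = "sqrt (trace S + 2 * sqrt (det S))"
  have "trace (sqrt_2 S) = (trace S + 2 * sqrt (det S)) / ?t"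
    by (simp add: sqrt_2_def trace_2 mat_def add_divide_distrib)
  also have "\<dots> = ?t"
    using trace_pos det_nonneg by (simp add: real_div_sqrt)
  finally show ?thesis .
qed

text \<open>With d = sqrt (det S) one has det (S + d I) = d (tr S + 2 d), and the bracket cancels
  against the square of the normalising factor.\<close>

lemma det_sqrt_2: "det (sqrt_2 S) = sqrt (det S)"
proof -
  let ?t = "sqrt (trace S + 2 * sqrt (det S))"
  have "?t\<^sup>2 = trace S + 2 * sqrt (det S)"
    using trace_pos det_nonneg by simp
  moreover have "?t\<^sup>2 * det (sqrt_2 S) = (?t * (1 / ?t))\<^sup>2 * det (S + mat (sqrt (det S)))"
    unfolding sqrt_2_def det_scaleR_2 power_mult_distrib by (rule mult.assoc[symmetric])
  then have "?t\<^sup>2 * det (sqrt_2 S) = det (S + mat (sqrt (det S)))"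
    using sqrt_2_denominator_pos by simp
  moreover have "det (S + mat (sqrt (det S))) = det S + sqrt (det S) * trace S + (sqrt (det S))\<^sup>2"
    by (simp add: det_2[of "S + _"] det_2[of S] trace_2 mat_def power2_eq_square algebra_simps)
  moreover have "\<dots> = sqrt (det S) * (trace S + 2 * sqrt (det S))"
    using det_nonneg by (simp add: algebra_simps)
  ultimately show ?thesis
    using sqrt_2_denominator_pos by (metis mult.commute mult_left_cancel power_not_zero less_irrefl)
qed

lemma sqrt_2_squared: "sqrt_2 S ** sqrt_2 S = S"
proof -
  let ?R = "sqrt_2 S" and ?t = "sqrt (trace S + 2 * sqrt (det S))"
  have "?R ** ?R = mat (trace ?R) ** ?R - mat (det ?R)"
    using cayley_hamilton_2[of ?R] by (simp add: eq_diff_eq)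
  also have "mat (trace ?R) ** ?R = ?t *\<^sub>R ?R"
    by (simp add: trace_sqrt_2 matrix_2_simps)
  also have "\<dots> = S + mat (sqrt (det S))"
    using sqrt_2_denominator_pos by (simp add: sqrt_2_def)
  finally show ?thesis
    by (simp add: det_sqrt_2)
qed

lemma transpose_sqrt_2: "transpose (sqrt_2 S) = sqrt_2 S" if "transpose S = S"
  using that by (simp add: symmetric_2 sqrt_2_def mat_def)

text \<open>Determinant and trace of a positive semidefinite root are nonnegative, so they are
  determined by their squares, which are computed from \<open>S\<close>; Cayley-Hamilton then
  recovers \<open>R\<close>.\<close>

lemma sqrt_2_unique:
  assumes R: "transpose R = R" "\<And>v. 0 \<le> v \<bullet> (R *v v)" "R ** R = S"
  shows "R = sqrt_2 S"
proof -
  have "det S = (det R)\<^sup>2"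
    using R(3) by (auto simp: det_mul power2_eq_square)
  then have det: "det R = sqrt (det S)"
    using psd_2(3)[OF R(1,2)] by simp
  have "trace S = (trace R)\<^sup>2 - 2 * det R"
    unfolding R(3)[symmetric]
    by (simp add: trace_2 det_2 matrix_matrix_mult_def sum_2 power2_eq_square algebra_simps)
  then have trace: "trace R = sqrt (trace S + 2 * sqrt (det S))"
    using psd_2(1,2)[OF R(1,2)] by (simp add: det trace_2)
  have "S + mat (sqrt (det S)) = trace R *\<^sub>R R"
    using cayley_hamilton_2[of R] by (simp add: R(3) det) (simp add: matrix_2_simps)
  then show ?thesis
    using sqrt_2_denominator_pos by (simp add: sqrt_2_def trace)
qed

lemma psd_sqrt_eq_sqrt_2:
  assumes sym: "transpose S = S"
  shows "psd_sqrt S = sqrt_2 S"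
  unfolding psd_sqrt_def
proof (rule the_equality)
  have "0 \<le> v \<bullet> (sqrt_2 S *v v)" for v
    using det_nonneg sqrt_2_denominator_pos
    by (intro psd_2I transpose_sqrt_2 sym) (simp_all add: trace_sqrt_2 det_sqrt_2)
  then show "transpose (sqrt_2 S) = sqrt_2 S \<and> (\<forall>v. 0 \<le> v \<bullet> (sqrt_2 S *v v)) \<and> sqrt_2 S ** sqrt_2 S = S"
    using transpose_sqrt_2[OF sym] sqrt_2_squared by simp
qed (use sqrt_2_unique in blast)

end

lemma sqrt_2_scaleR:
  assumes "0 < c"
  shows "sqrt_2 (c\<^sup>2 *\<^sub>R S) = c *\<^sub>R sqrt_2 S"
proof -
  have d: "sqrt (det (c\<^sup>2 *\<^sub>R S)) = c\<^sup>2 * sqrt (det S)"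
    unfolding det_scaleR_2 real_sqrt_mult by (simp only: real_sqrt_abs abs_power2)
  have "trace (c\<^sup>2 *\<^sub>R S) + 2 * (c\<^sup>2 * sqrt (det S)) = c\<^sup>2 * (trace S + 2 * sqrt (det S))"
    by (simp add: trace_scaleR algebra_simps)
  then have t: "sqrt (trace (c\<^sup>2 *\<^sub>R S) + 2 * (c\<^sup>2 * sqrt (det S))) = c * sqrt (trace S + 2 * sqrt (det S))"
    using assms by (simp add: real_sqrt_mult)
  show ?thesis
    unfolding sqrt_2_def d t using assms
    by (simp add: matrix_2_simps power2_eq_square field_simps)
qed

section \<open>Adjugates, inverses and absolute values of 2x2 matrices\<close>

definition adj_2 :: "real^2^2 \<Rightarrow> real^2^2" where
  "adj_2 A = m2 (A$2$2) (- A$1$2) (- A$2$1) (A$1$1)"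

lemma m2_nth [simp]:
  "m2 a b c d $ 1 $ 1 = a" "m2 a b c d $ 1 $ 2 = b" "m2 a b c d $ 2 $ 1 = c" "m2 a b c d $ 2 $ 2 = d"
  by (simp_all add: m2_def)

lemma matrix_inv_eqI:
  fixes A B :: "'a::semiring_1^'n^'n"
  assumes "A ** B = mat 1" "B ** A = mat 1"
  shows "matrix_inv A = B"
proof -
  have "A ** matrix_inv A = mat 1 \<and> matrix_inv A ** A = mat 1"
    unfolding matrix_inv_def by (rule someI[of _ B]) (use assms in simp)
  then show ?thesis
    by (metis assms(2) matrix_mul_assoc matrix_mul_lid matrix_mul_rid)
qed

lemma matrix_inv_2:
  assumes "det A \<noteq> 0"
  shows "matrix_inv A = (1 / det A) *\<^sub>R adj_2 A"
proof (rule matrix_inv_eqI)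
  have "A ** adj_2 A = det A *\<^sub>R mat 1" "adj_2 A ** A = det A *\<^sub>R mat 1"
    by (simp_all add: matrix_2_simps adj_2_def det_2 algebra_simps)
  then show "A ** ((1 / det A) *\<^sub>R adj_2 A) = mat 1" "(1 / det A) *\<^sub>R adj_2 A ** A = mat 1"
    using assms by (simp_all add: matrix_scalar_ac flip: scalar_matrix_assoc)
qed

lemma bounded_linear_adj_2: "bounded_linear adj_2"
  by (intro linear_conv_bounded_linear[THEN iffD1] linearI)
    (simp_all add: adj_2_def vec_eq_iff forall_2)

lemma trace_transpose_mult_nonneg: "0 \<le> trace (transpose A ** A)" for A :: "real^2^2"
  by (simp add: trace_2 matrix_matrix_mult_def transpose_def sum_2)

lemma trace_transpose_mult_pos:
  fixes A :: "real^2^2"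
  assumes "det A \<noteq> 0"
  shows "0 < trace (transpose A ** A)"
proof -
  have "A$1$1 \<noteq> 0 \<or> A$2$1 \<noteq> 0"
    using assms by (auto simp: det_2)
  then show ?thesis
    by (simp add: trace_2 matrix_matrix_mult_def transpose_def sum_2
        add_pos_nonneg sum_power2_gt_zero_iff flip: power2_eq_square)
qed

lemma det_transpose_mult: "det (transpose A ** A) = (det A)\<^sup>2" for A :: "real^'n^'n"
  by (simp add: det_mul power2_eq_square)

text \<open>Explicit formula for the root of |M|, free of the definite description in
  \<open>psd_sqrt\<close>, so that the closure rules for weighted Lipschitz functions apply to
  it.\<close>

definition root_abs_2 :: "real^2^2 \<Rightarrow> real^2^2" where
  "root_abs_2 M = sqrt_2 (sqrt_2 (transpose M ** M))"

context
  fixes M :: "real^2^2"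
  assumes det_M: "det M \<noteq> 0"
begin

lemma gram_pos: "0 < trace (transpose M ** M)" "0 \<le> det (transpose M ** M)"
  using det_M by (simp_all add: trace_transpose_mult_pos det_transpose_mult)

lemma abs_2_pos:
  "0 < trace (sqrt_2 (transpose M ** M))" "0 \<le> det (sqrt_2 (transpose M ** M))"
  using sqrt_2_denominator_pos[OF gram_pos] gram_pos
  by (simp_all add: trace_sqrt_2 det_sqrt_2)

lemma psd_sqrt_absM: "psd_sqrt (absM M) = root_abs_2 M"
proof -
  have "absM M = sqrt_2 (transpose M ** M)"
    unfolding absM_def by (intro psd_sqrt_eq_sqrt_2 gram_pos) (simp add: matrix_transpose_mul)
  then show ?thesis
    unfolding root_abs_2_def
    by (simp add: psd_sqrt_eq_sqrt_2 abs_2_pos transpose_sqrt_2 gram_pos matrix_transpose_mul)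
qed

lemma det_root_abs_2: "det (root_abs_2 M) = sqrt \<bar>det M\<bar>"
  unfolding root_abs_2_def
  by (simp only: det_sqrt_2[OF abs_2_pos] det_sqrt_2[OF gram_pos] det_transpose_mult real_sqrt_abs)

end

text \<open>The Gram matrix acquires the factor c^4, and the two nested roots reduce it to c^2 and
  then to c. This is why the weight enters \<open>M\<close> squared.\<close>

lemma root_abs_2_scaleR:
  assumes "0 < c"
  shows "root_abs_2 (c\<^sup>2 *\<^sub>R M) = c *\<^sub>R root_abs_2 M"
proof -
  have "transpose (c\<^sup>2 *\<^sub>R M) ** (c\<^sup>2 *\<^sub>R M) = (c\<^sup>2)\<^sup>2 *\<^sub>R (transpose M ** M)"
    by (simp add: matrix_2_simps power2_eq_square algebra_simps)
  then show ?thesis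
    using assms by (simp only: root_abs_2_def sqrt_2_scaleR zero_less_power)
qed

section \<open>Matrix operations on weighted Lipschitz functions\<close>

lemma bounded_bilinear_matrix_mult:
  "bounded_bilinear ((**) :: 'a::{real_algebra_1,euclidean_space}^'n^'m \<Rightarrow> 'a^'k^'n \<Rightarrow> 'a^'k^'m)"
  unfolding bilinear_conv_bounded_bilinear[symmetric] bilinear_def
  by (intro conjI allI linearI)
    (simp_all add: matrix_matrix_mult_def vec_eq_iff distrib_left distrib_right sum.distrib
      scaleR_sum_right)

lemma bounded_linear_transpose: "bounded_linear (transpose :: real^'n^'m \<Rightarrow> real^'m^'n)"
  by (intro linear_conv_bounded_linear[THEN iffD1] linearI) (simp_all add: transpose_def vec_eq_iff)

lemma bounded_linear_mat: "bounded_linear (mat :: real \<Rightarrow> real^'n^'n)"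
  by (intro linear_conv_bounded_linear[THEN iffD1] linearI) (simp_all add: mat_def vec_eq_iff)

context
  fixes \<rho> :: "'m::metric_space \<Rightarrow> real"
  assumes weight_nonneg: "\<And>x. 0 \<le> \<rho> x"
begin

lemmas weighted_lipschitz_matrix_mult =
  weighted_lipschitz_bilinear[OF weight_nonneg bounded_bilinear_matrix_mult]

lemmas weighted_lipschitz_transpose =
  weighted_lipschitz_linear[OF weight_nonneg bounded_linear_transpose]
lemmas weighted_lipschitz_mat =
  weighted_lipschitz_linear[OF weight_nonneg bounded_linear_mat]

lemma weighted_lipschitz_trace_det_2:
  fixes F :: "'m \<Rightarrow> real^2^2"
  assumes "weighted_lipschitz \<rho> F"
  shows weighted_lipschitz_trace_2: "weighted_lipschitz \<rho> (\<lambda>x. trace (F x))"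
    and weighted_lipschitz_det_2: "weighted_lipschitz \<rho> (\<lambda>x. det (F x))"
  unfolding trace_2 det_2
  by (intro weighted_lipschitz_add weighted_lipschitz_diff weighted_lipschitz_mult
      weighted_lipschitz_nth weight_nonneg assms)+

text \<open>The lower bound on the determinant keeps both scalar roots in \<open>sqrt_2\<close> away
  from zero: the outer radicand is at least \<open>2 * sqrt c\<close>.\<close>

lemma weighted_lipschitz_sqrt_2:
  assumes S: "weighted_lipschitz \<rho> S" and c: "0 < c" "\<And>x. c \<le> det (S x)" "\<And>x. 0 \<le> trace (S x)"
  shows "weighted_lipschitz \<rho> (\<lambda>x. sqrt_2 (S x))"
proof -
  have sd: "weighted_lipschitz \<rho> (\<lambda>x. sqrt (det (S x)))"
    by (rule weighted_lipschitz_sqrt[OF weight_nonneg _ c(1,2)])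
      (rule weighted_lipschitz_det_2[OF S])
  have le: "2 * sqrt c \<le> trace (S x) + 2 * sqrt (det (S x))" for x
    using c(3)[of x] c(2)[of x] by (simp add: add_increasing)
  have st: "weighted_lipschitz \<rho> (\<lambda>x. sqrt (trace (S x) + 2 * sqrt (det (S x))))"
    by (rule weighted_lipschitz_sqrt[OF weight_nonneg _ _ le])
      (intro weighted_lipschitz_add weighted_lipschitz_mult weighted_lipschitz_const
        weighted_lipschitz_trace_2 weight_nonneg sd S, use c in simp)
  have inv: "weighted_lipschitz \<rho> (\<lambda>x. 1 / sqrt (trace (S x) + 2 * sqrt (det (S x))))"
  proof (rule weighted_lipschitz_divide[OF weight_nonneg _ st])
    show "sqrt (2 * sqrt c) \<le> \<bar>sqrt (trace (S x) + 2 * sqrt (det (S x)))\<bar>" for x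
      using le[of x] by (simp add: order_trans[OF _ abs_ge_self])
  qed (use c in auto)
  show ?thesis
    unfolding sqrt_2_def
    by (intro weighted_lipschitz_scaleR weighted_lipschitz_add weighted_lipschitz_mat
        weight_nonneg inv sd S)
qed

text \<open>The Gram matrix has determinant (det G)^2, at least c^2, and its root has determinant
  |det G|, at least c; so both nested roots are nondegenerate.\<close>

lemma weighted_lipschitz_root_abs_2:
  assumes G: "weighted_lipschitz \<rho> G" and c: "0 < c" "\<And>x. c \<le> \<bar>det (G x)\<bar>"
  shows "weighted_lipschitz \<rho> (\<lambda>x. root_abs_2 (G x))"
  unfolding root_abs_2_def
proof (rule weighted_lipschitz_sqrt_2)
  have nz: "det (G x) \<noteq> 0" for x
    using c(1) c(2)[of x] by auto
  have "c\<^sup>2 \<le> det (transpose (G x) ** G x)" for x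
    using power_mono[OF c(2)[of x], of 2] c(1) by (simp add: det_transpose_mult)
  then show "weighted_lipschitz \<rho> (\<lambda>x. sqrt_2 (transpose (G x) ** G x))"
    by (intro weighted_lipschitz_sqrt_2[of _ "c\<^sup>2"] weighted_lipschitz_matrix_mult
        weighted_lipschitz_transpose G)
      (use c in \<open>simp_all add: trace_transpose_mult_nonneg\<close>)
  show "c \<le> det (sqrt_2 (transpose (G x) ** G x))" for x
    using c(2)[of x]
    by (simp only: det_sqrt_2[OF gram_pos[OF nz]] det_transpose_mult real_sqrt_abs)
  show "0 \<le> trace (sqrt_2 (transpose (G x) ** G x))" for x
    using abs_2_pos(1)[OF nz] by (rule less_imp_le)
qed (rule c)

end

lemma bounded_linear_blk_cmat:
  "bounded_linear (\<lambda>X. blk (cmat X) 0 0 0)" "bounded_linear (\<lambda>X. blk 0 0 (cmat X) 0)"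
proof -
  have "linear (\<lambda>X. blk (cmat X) 0 0 0)" "linear (\<lambda>X. blk 0 0 (cmat X) 0)"
    by (intro linearI; simp add: blk_def cmat_def vec_eq_iff complex_eq_iff split: sum.split)+
  then show "bounded_linear (\<lambda>X. blk (cmat X) 0 0 0)" "bounded_linear (\<lambda>X. blk 0 0 (cmat X) 0)"
    by (simp_all add: linear_conv_bounded_linear)
qed

text \<open>With \<open>M = \<rho>\<^sup>2 G\<close>, both \<open>|M|\<^sup>1\<^sup>/\<^sup>2\<close> and \<open>M |M|\<^sup>-\<^sup>1\<^sup>/\<^sup>2\<close> are \<open>\<rho>\<close> times a function of \<open>G\<close> that is smooth
  away from \<open>det G = 0\<close>.\<close>

lemma bounded_lipschitz_cgl_R:
  assumes \<rho>: "\<And>x. 0 < \<rho> x" "bounded_lipschitz \<rho>"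
    and M: "\<And>x. M x = (\<rho> x)\<^sup>2 *\<^sub>R G x"
    and G: "weighted_lipschitz \<rho> G" and c: "0 < c" "\<And>x. c \<le> \<bar>det (G x)\<bar>"
  shows "bounded_lipschitz (\<lambda>x. cgl_Rr (M x))"
    and "bounded_lipschitz (\<lambda>x. cgl_Rl B (M x))"
proof -
  let ?H = "\<lambda>x. root_abs_2 (G x)"
  have \<rho>0: "0 \<le> \<rho> x" for x
    using \<rho>(1) by (rule less_imp_le)
  have nz: "det (G x) \<noteq> 0" for x
    using c(1) c(2)[of x] by auto
  have "det (M x) \<noteq> 0" for x
    using nz[of x] \<rho>(1)[of x] by (simp add: M det_scaleR_2)
  then have root: "psd_sqrt (absM (M x)) = \<rho> x *\<^sub>R ?H x" for x
    using \<rho>(1)[of x] by (simp add: psd_sqrt_absM) (simp add: M root_abs_2_scaleR)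
  have H: "weighted_lipschitz \<rho> ?H"
    by (rule weighted_lipschitz_root_abs_2[OF \<rho>0 G c])
  show "bounded_lipschitz (\<lambda>x. cgl_Rr (M x))"
    unfolding cgl_Rr_def root
    by (rule weighted_lipschitz_linear[OF _ bounded_linear_blk_cmat(1),
          OF _ weighted_lipschitz_times_weight[OF H \<rho>(2) \<rho>0]]) simp_all
  have det_H: "det (?H x) = sqrt \<bar>det (G x)\<bar>" for x
    by (rule det_root_abs_2[OF nz])
  have inv: "matrix_inv (\<rho> x *\<^sub>R ?H x) = (1 / \<rho> x) *\<^sub>R ((1 / det (?H x)) *\<^sub>R adj_2 (?H x))" for x
    using nz[of x] \<rho>(1)[of x]
    by (simp add: matrix_inv_2 det_scaleR_2 det_H power2_eq_square
        linear_scale[OF bounded_linear.linear[OF bounded_linear_adj_2]])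
  \<comment> \<open>The squared weight in \<open>M x\<close> meets the reciprocal weight from the
    inverse root, and one factor \<open>\<rho> x\<close> survives.\<close>
  have Rl: "- (matrix_inv B ** M x ** matrix_inv (\<rho> x *\<^sub>R ?H x))
      = \<rho> x *\<^sub>R (- (matrix_inv B ** G x ** ((1 / det (?H x)) *\<^sub>R adj_2 (?H x))))" for x
    using \<rho>(1)[of x] unfolding inv M
    by (simp add: matrix_scalar_ac power2_eq_square flip: scalar_matrix_assoc)
  have "weighted_lipschitz \<rho> (\<lambda>x. 1 / det (?H x))"
  proof (rule weighted_lipschitz_divide[OF \<rho>0])
    show "weighted_lipschitz \<rho> (\<lambda>x. det (?H x))"
      by (rule weighted_lipschitz_det_2[OF \<rho>0 H])
    show "0 < sqrt c" "sqrt c \<le> \<bar>det (?H x)\<bar>" for x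
      using c by (simp_all add: det_H)
  qed simp
  then have N: "weighted_lipschitz \<rho> (\<lambda>x. - (matrix_inv B ** G x ** ((1 / det (?H x)) *\<^sub>R adj_2 (?H x))))"
    by (intro weighted_lipschitz_minus weighted_lipschitz_matrix_mult weighted_lipschitz_const
        weighted_lipschitz_scaleR weighted_lipschitz_linear[OF _ bounded_linear_adj_2] \<rho>0 G H)
  show "bounded_lipschitz (\<lambda>x. cgl_Rl B (M x))"
    unfolding cgl_Rl_def root Rl
    by (rule weighted_lipschitz_linear[OF _ bounded_linear_blk_cmat(2),
          OF _ weighted_lipschitz_times_weight[OF N \<rho>(2) \<rho>0]]) simp_all
qed

section \<open>Size and direction in the matrix M, and a lower bound at infinity\<close>

lemma rotm_add: "rotm a b + rotm c d = rotm (a + c) (b + d)"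
  by (simp add: rotm_def vec_eq_iff forall_2)

lemma rotm_scaleR: "c *\<^sub>R rotm a b = rotm (c * a) (c * b)"
  by (simp add: rotm_def vec_eq_iff forall_2)

lemma vec2_nth [simp]: "vec2 z $ 1 = Re z" "vec2 z $ 2 = Im z"
  by (simp_all add: vec2_def)

lemma norm_vec2 [simp]: "norm (vec2 z) = cmod z"
  by (simp add: norm_vec_def L2_set_def sum_2 cmod_def)

text \<open>For nonzero \<open>z\<close> this is the orthogonal projection onto the real line
  through \<open>z\<close>. It carries the whole dependence of M on the direction of psi.\<close>

definition radial_proj :: "complex \<Rightarrow> real^2^2" where
  "radial_proj z = (\<chi> i j. (vec2 z $ i / cmod z) * (vec2 z $ j / cmod z))"

text \<open>Rotating \<open>z\<close> conjugates the matrix by a rotation, which commutes with every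
  \<open>rotm\<close>. Hence the determinant does not see the direction; in coordinates it enters
  only through p^2 + q^2 = 1.\<close>

lemma det_rotm_radial_proj:
  assumes "z \<noteq> 0"
  shows "det (rotm a b + rotm c d ** radial_proj z) = a\<^sup>2 + b\<^sup>2 + a * c + b * d"
proof -
  define p q where "p = Re z / cmod z" and "q = Im z / cmod z"
  have "p\<^sup>2 + q\<^sup>2 = ((Re z)\<^sup>2 + (Im z)\<^sup>2) / (cmod z)\<^sup>2"
    by (simp add: p_def q_def power_divide add_divide_distrib)
  then have pq: "p\<^sup>2 + q\<^sup>2 = 1"
    using assms by (simp flip: cmod_power2)
  have proj: "radial_proj z = m2 (p * p) (p * q) (q * p) (q * q)"
    by (simp add: radial_proj_def vec_eq_iff forall_2 p_def q_def)
  have "det (rotm a b + rotm c d ** radial_proj z)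
      = a\<^sup>2 + b\<^sup>2 + (a * c + b * d) * (p\<^sup>2 + q\<^sup>2)"
    by (simp add: det_2 rotm_def matrix_matrix_mult_def sum_2 proj algebra_simps power2_eq_square)
  then show ?thesis
    by (simp add: pq)
qed

lemma matrix_mult_scaleR_right:
  fixes A :: "'a::real_algebra_1^'n^'m"
  shows "A ** (k *\<^sub>R B) = k *\<^sub>R (A ** B)"
  by (simp only: matrix_scalar_ac scalar_matrix_assoc)

lemma cgl_M_eq:
  assumes "z \<noteq> 0" and s: "s = (cmod z)\<^sup>2"
  shows "cgl_M \<epsilon> \<gamma> \<mu> \<nu> z = s *\<^sub>R (rotm (\<epsilon> + s * \<mu>) (\<gamma> + s * \<nu>)
    + rotm (2 * \<epsilon> + 4 * s * \<mu>) (2 * \<gamma> + 4 * s * \<nu>) ** radial_proj z)"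
proof -
  have "(\<chi> i j. vec2 z $ i * vec2 z $ j) = s *\<^sub>R radial_proj z"
    using assms by (simp add: radial_proj_def vec_eq_iff power2_eq_square)
  moreover have "(cmod z)^4 = s * s"
    by (simp add: s flip: power2_eq_square)
  ultimately have "cgl_M \<epsilon> \<gamma> \<mu> \<nu> z = s *\<^sub>R ((rotm \<epsilon> \<gamma> + s *\<^sub>R rotm \<mu> \<nu>)
      + (2 *\<^sub>R rotm \<epsilon> \<gamma> + (4 * s) *\<^sub>R rotm \<mu> \<nu>) ** radial_proj z)"
    by (simp add: cgl_M_def matrix_mult_scaleR_right scaleR_add_right flip: s)
  then show ?thesis
    by (simp only: rotm_add rotm_scaleR)
qed

lemma cgl_M_0: "cgl_M \<epsilon> \<gamma> \<mu> \<nu> 0 = 0"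
  by (simp add: cgl_M_def matrix_2_simps)

lemma weighted_lipschitz_radial_proj:
  fixes \<psi> :: "'m::metric_space \<Rightarrow> complex"
  assumes nz: "\<And>x. \<psi> x \<noteq> 0" and \<psi>: "bounded_lipschitz \<psi>"
  shows "weighted_lipschitz (\<lambda>x. cmod (\<psi> x)) (\<lambda>x. radial_proj (\<psi> x))"
proof -
  obtain L where L: "L > 0" "\<And>x y. 1 * norm (\<psi> x - \<psi> y) \<le> L * dist x y"
    using weighted_lipschitzE[OF \<psi>] by metis
  have sgn: "weighted_lipschitz (\<lambda>x. cmod (\<psi> x)) (\<lambda>x. sgn (\<psi> x))"
  proof (rule weighted_lipschitzI)
    show "norm (sgn (\<psi> x)) \<le> 1" for x
      by (simp add: norm_sgn)
    fix x y
    let ?u = "\<psi> x" and ?v = "\<psi> y"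
    have "norm ?u * norm (sgn ?u - sgn ?v) = norm (norm ?u *\<^sub>R (sgn ?u - sgn ?v))"
      by simp
    \<comment> \<open>After multiplication by |u| no small denominator is left: both terms are
      bounded by |u - v|.\<close>
    also have "norm ?u *\<^sub>R (sgn ?u - sgn ?v) = (?u - ?v) + (norm ?v - norm ?u) *\<^sub>R sgn ?v"
      using nz[of x] nz[of y] by (simp add: sgn_div_norm algebra_simps)
    also have "norm \<dots> \<le> norm (?u - ?v) + \<bar>norm ?v - norm ?u\<bar>"
      using nz[of y] by (intro norm_triangle_le) (simp add: norm_sgn)
    also have "\<dots> \<le> (2 * L) * dist x y"
      using L(2)[of x y] norm_triangle_ineq3[of ?u ?v] by (simp add: abs_minus_commute)
    finally show "norm ?u * norm (sgn ?u - sgn ?v) \<le> (2 * L) * dist x y" .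
  qed
  have "vec2 z $ i / cmod z = (if i = 1 then Re (sgn z) else Im (sgn z))" for z i
    using exhaust_2[of i] by (auto simp: Re_sgn Im_sgn)
  then have "weighted_lipschitz (\<lambda>x. cmod (\<psi> x)) (\<lambda>x. vec2 (\<psi> x) $ i / cmod (\<psi> x))" for i
    using weighted_lipschitz_linear[OF _ bounded_linear_Re sgn]
      weighted_lipschitz_linear[OF _ bounded_linear_Im sgn] by (cases "i = 1") auto
  then show ?thesis
    by (intro weighted_lipschitz_vec; simp only: radial_proj_def vec_lambda_beta norm_ge_zero)
      (rule weighted_lipschitz_mult; simp)
qed

lemma bounded_away_from_zero:
  fixes f :: "'a::euclidean_space \<Rightarrow> real"
  assumes cont: "continuous_on UNIV f" and lim: "(f \<longlongrightarrow> l) at_infinity" and "l \<noteq> 0"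
    and nz: "\<And>x. f x \<noteq> 0"
  obtains c where "0 < c" "\<And>x. c \<le> \<bar>f x\<bar>"
proof -
  have "((\<lambda>x. \<bar>f x\<bar>) \<longlongrightarrow> \<bar>l\<bar>) at_infinity"
    by (intro tendsto_rabs lim)
  then have "eventually (\<lambda>x. \<bar>l\<bar> / 2 < \<bar>f x\<bar>) at_infinity"
    using \<open>l \<noteq> 0\<close> by (intro order_tendstoD) auto
  then obtain b where b: "\<And>x. b \<le> norm x \<Longrightarrow> \<bar>l\<bar> / 2 < \<bar>f x\<bar>"
    by (auto simp: eventually_at_infinity)
  \<comment> \<open>The tail is bounded below by half the limit, so a minimum on a compact ball
    remains. The radius is \<open>\<bar>b\<bar>\<close> because \<open>b\<close> may be negative and
    the ball must be nonempty.\<close>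
  have "\<exists>x\<in>cball 0 \<bar>b\<bar>. \<forall>y\<in>cball 0 \<bar>b\<bar>. \<bar>f x\<bar> \<le> \<bar>f y\<bar>"
    by (intro continuous_attains_inf compact_cball continuous_on_rabs continuous_on_subset[OF cont])
      auto
  then obtain x where x: "\<And>y. norm y \<le> \<bar>b\<bar> \<Longrightarrow> \<bar>f x\<bar> \<le> \<bar>f y\<bar>"
    by (metis mem_cball_0)
  show thesis
  proof (rule that[of "min (\<bar>l\<bar> / 2) \<bar>f x\<bar>"])
    show "min (\<bar>l\<bar> / 2) \<bar>f x\<bar> \<le> \<bar>f y\<bar>" for y
      using b[of y] x[of y] by fastforce
  qed (use \<open>l \<noteq> 0\<close> nz in auto)
qed

section \<open>Spectral resolutions\<close>

definition cscale :: "complex \<Rightarrow> complex^'n^'m \<Rightarrow> complex^'n^'m" where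
  "cscale z A = (\<chi> i j. z * A $ i $ j)"

lemma cscale_nth [simp]: "cscale z A $ i $ j = z * A $ i $ j"
  by (simp add: cscale_def)

lemma cscale_1 [simp]: "cscale 1 A = A"
  and cscale_0 [simp]: "cscale 0 A = 0"
  and cscale_zero [simp]: "cscale z 0 = 0"
  by (simp_all add: vec_eq_iff)

lemma cscale_add_left: "cscale (z + w) A = cscale z A + cscale w A"
  and cscale_diff_left: "cscale (z - w) A = cscale z A - cscale w A"
  and cscale_minus_left: "cscale (- z) A = - cscale z A"
  by (simp_all add: vec_eq_iff algebra_simps)

lemma bounded_bilinear_cscale: "bounded_bilinear (cscale :: complex \<Rightarrow> complex^'n^'m \<Rightarrow> _)"
  unfolding bilinear_conv_bounded_bilinear[symmetric] bilinear_def
  by (intro conjI allI linearI) (simp_all add: vec_eq_iff algebra_simps)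

lemma cscale_mult: "cscale z A ** cscale w B = cscale (z * w) (A ** B)"
  by (simp add: vec_eq_iff matrix_matrix_mult_def sum_distrib_left mult_ac)

lemma sum_matrix_vector_mult:
  fixes A :: "'i \<Rightarrow> 'a::ring_1^'n^'m"
  shows "(\<Sum>i\<in>I. A i) *v v = (\<Sum>i\<in>I. A i *v v)"
  by (induction I rule: infinite_finite_induct) (simp_all add: matrix_vector_mult_add_rdistrib)

text \<open>Diagonalisability in terms of projections. Functions live on the index set rather than
  on the spectrum, so eigenvalues belonging to different indices may coincide.\<close>

locale spectral_resolution =
  fixes P :: "'i::finite \<Rightarrow> complex^'n^'n"
  assumes orthogonal: "P i ** P j = (if i = j then P i else 0)"
    and complete: "(\<Sum>i\<in>UNIV. P i) = mat 1"
begin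

definition calculus :: "('i \<Rightarrow> complex) \<Rightarrow> complex^'n^'n" where
  "calculus f = (\<Sum>i\<in>UNIV. cscale (f i) (P i))"

lemma calculus_mult: "calculus f ** calculus g = calculus (\<lambda>i. f i * g i)"
proof -
  have "calculus f ** calculus g
      = (\<Sum>i\<in>UNIV. \<Sum>j\<in>UNIV. cscale (f i) (P i) ** cscale (g j) (P j))"
    unfolding calculus_def
    by (simp add: bounded_bilinear.sum_left[OF bounded_bilinear_matrix_mult]
        bounded_bilinear.sum_right[OF bounded_bilinear_matrix_mult]) (rule sum.swap)
  also have "\<dots> = (\<Sum>i\<in>UNIV. \<Sum>j\<in>UNIV. if i = j then cscale (f i * g j) (P i) else 0)"
    by (intro sum.cong refl) (simp add: cscale_mult orthogonal)
  finally show ?thesis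
    by (simp add: calculus_def)
qed

lemma calculus_diff: "calculus (\<lambda>i. f i - g i) = calculus f - calculus g"
  by (simp add: calculus_def cscale_diff_left sum_subtractf)

lemma calculus_minus: "calculus (\<lambda>i. - f i) = - calculus f"
  by (simp add: calculus_def cscale_minus_left sum_negf)

lemma calculus_const: "calculus (\<lambda>_. z) = mat z"
proof -
  have "calculus (\<lambda>_. z) = cscale z (\<Sum>i\<in>UNIV. P i)"
    unfolding calculus_def
    by (rule bounded_bilinear.sum_right[OF bounded_bilinear_cscale, symmetric])
  then show ?thesis
    by (simp add: complete vec_eq_iff mat_def)
qed

lemma calculus_scaleR: "r *\<^sub>R calculus f = calculus (\<lambda>i. of_real r * f i)"
  by (simp add: calculus_def scaleR_sum_right scaleR_conv_of_real[symmetric, where 'a = complex]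
      bounded_bilinear.scaleR_left[OF bounded_bilinear_cscale])

lemma calculus_delta: "calculus (\<lambda>j. of_bool (j = i)) = P i"
  by (simp add: calculus_def of_bool_def if_distrib[of "\<lambda>z. cscale z _"] cong: if_cong)

lemma matpow_calculus: "matpow (calculus f) k = calculus (\<lambda>i. f i ^ k)"
  by (induction k) (simp_all add: calculus_const calculus_mult)

lemma mexp_calculus: "mexp (calculus f) = calculus (\<lambda>i. exp (f i))"
proof -
  have "(\<lambda>k. inverse (fact k) *\<^sub>R cscale (f i ^ k) (P i)) sums cscale (exp (f i)) (P i)" for i
    using bounded_linear.sums[OF bounded_bilinear.bounded_linear_left[OF bounded_bilinear_cscale]
        exp_converges[of "f i"], of "P i"]
    by (simp add: bounded_bilinear.scaleR_left[OF bounded_bilinear_cscale])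
  then have "(\<lambda>k. \<Sum>i\<in>UNIV. inverse (fact k) *\<^sub>R cscale (f i ^ k) (P i)) sums calculus (\<lambda>i. exp (f i))"
    unfolding calculus_def by (intro sums_sum)
  then show ?thesis
    unfolding mexp_def matpow_calculus
    by (simp add: calculus_def scaleR_sum_right sums_iff)
qed

text \<open>The predicate \<open>p\<close> is arbitrary so that one proof serves both the stable and
  the unstable subspace.\<close>

lemma span_gen_eigenspaces:
  "span (\<Union>\<mu>\<in>{\<mu>. p \<mu>}. gen_eigenspace (calculus f) \<mu>)
    = range (\<lambda>v. calculus (\<lambda>i. of_bool (p (f i))) *v v)" (is "span ?E = range (\<lambda>v. ?Q *v v)")
proof
  have ker: "gen_eigenspace (calculus f) \<mu> = {v. calculus (\<lambda>i. (f i - \<mu>) ^ CARD('n)) *v v = 0}" for \<mu>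
    unfolding gen_eigenspace_def calculus_const[symmetric] calculus_diff[symmetric] matpow_calculus ..
  show "span ?E \<subseteq> range (\<lambda>v. ?Q *v v)"
  proof (rule span_minimal)
    show "subspace (range (\<lambda>v. ?Q *v v))"
      by (intro linear_subspace_image subspace_UNIV linearI matrix_vector_right_distrib)
        (simp add: vec_eq_iff matrix_vector_mult_def scaleR_sum_right)
    show "?E \<subseteq> range (\<lambda>v. ?Q *v v)"
    proof clarify
      fix \<mu> v
      assume p: "p \<mu>" and v: "v \<in> gen_eigenspace (calculus f) \<mu>"
      \<comment> \<open>Since \<open>inverse 0 = 0\<close>, this is a pseudo-inverse: its product
        with the power is the projection onto the indices with
        \<open>f i \<noteq> \<mu>\<close>.\<close>
      let ?S = "calculus (\<lambda>i. inverse ((f i - \<mu>) ^ CARD('n)))"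
      have "(?S ** calculus (\<lambda>i. (f i - \<mu>) ^ CARD('n))) *v v = 0"
        using v unfolding ker matrix_vector_mul_assoc[symmetric] by simp
      also have "?S ** calculus (\<lambda>i. (f i - \<mu>) ^ CARD('n)) = calculus (\<lambda>i. 1 - of_bool (f i = \<mu>))"
        unfolding calculus_mult by (intro arg_cong[of _ _ calculus] ext) simp
      finally have "v = calculus (\<lambda>i. of_bool (f i = \<mu>)) *v v"
        by (simp add: calculus_diff calculus_const matrix_vector_mult_diff_rdistrib)
      also have "calculus (\<lambda>i. of_bool (f i = \<mu>)) = ?Q ** calculus (\<lambda>i. of_bool (f i = \<mu>))"
        unfolding calculus_mult using p by (intro arg_cong[of _ _ calculus] ext) auto
      finally show "v \<in> range (\<lambda>v. ?Q *v v)"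
        unfolding matrix_vector_mul_assoc[symmetric] by blast
    qed
  qed
  show "range (\<lambda>v. ?Q *v v) \<subseteq> span ?E"
  proof clarify
    fix v
    have "?Q = (\<Sum>i\<in>UNIV. if p (f i) then P i else 0)"
      by (auto simp: calculus_def intro: sum.cong)
    also have "\<dots> = (\<Sum>i | p (f i). P i)"
      by (simp add: sum.If_cases)
    finally have "?Q *v v = (\<Sum>i | p (f i). P i *v v)"
      by (simp add: sum_matrix_vector_mult)
    moreover have "P i *v v \<in> gen_eigenspace (calculus f) (f i)" for i
    proof -
      have "calculus (\<lambda>j. (f j - f i) ^ CARD('n)) ** P i = calculus (\<lambda>j. 0)"
        unfolding calculus_delta[of i, symmetric] calculus_mult
        by (intro arg_cong[of _ _ calculus] ext) auto
      then show ?thesis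
        by (simp add: ker matrix_vector_mul_assoc calculus_const)
    qed
    then have "P i *v v \<in> span ?E" if "p (f i)" for i
      using that by (intro span_base) blast
    ultimately show "?Q *v v \<in> span ?E"
      by (simp only:) (rule span_sum, simp)
  qed
qed

lemma stable_proj_calculus:
  assumes hyperbolic: "\<And>i. Re (f i) \<noteq> 0"
  shows "stable_proj (calculus f) = calculus (\<lambda>i. of_bool (Re (f i) < 0))" (is "_ = ?Q")
  unfolding stable_proj_def
proof (rule the_equality)
  let ?U = "calculus (\<lambda>i. of_bool (Re (f i) > 0))"
  have range: "stable_subspace (calculus f) = range (\<lambda>v. ?Q *v v)"
    "unstable_subspace (calculus f) = range (\<lambda>v. ?U *v v)"
    unfolding stable_subspace_def unstable_subspace_def by (rule span_gen_eigenspaces)+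
  have idem: "?Q ** ?Q = ?Q"
    by (simp add: calculus_mult flip: of_bool_conj)
  \<comment> \<open>No value has real part zero, so the unstable indices are the complement of the
    stable ones.\<close>
  have "?U = calculus (\<lambda>i. 1 - of_bool (Re (f i) < 0))"
    using hyperbolic by (intro arg_cong[of _ _ calculus] ext) (auto simp: less_le not_less)
  then have U: "?U = mat 1 - ?Q"
    by (simp add: calculus_diff calculus_const)
  have U_v: "?U *v v = v - ?Q *v v" for v
    by (simp add: U matrix_vector_mult_diff_rdistrib)
  have ker: "{v. ?Q *v v = 0} = unstable_subspace (calculus f)"
    unfolding range U_v
  proof (intro equalityI subsetI)
    fix v assume "v \<in> range (\<lambda>v. v - ?Q *v v)"
    then show "v \<in> {v. ?Q *v v = 0}"
      by (auto simp: matrix_vector_mult_diff_distrib matrix_vector_mul_assoc idem)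
  next
    fix v assume "v \<in> {v. ?Q *v v = 0}"
    then have "v = v - ?Q *v v"
      by simp
    then show "v \<in> range (\<lambda>v. v - ?Q *v v)"
      by (rule range_eqI)
  qed
  show "?Q ** ?Q = ?Q \<and> range (\<lambda>v. ?Q *v v) = stable_subspace (calculus f) \<and>
      {v. ?Q *v v = 0} = unstable_subspace (calculus f)"
    using idem range ker by simp
  fix R
  assume R: "R ** R = R \<and> range (\<lambda>v. R *v v) = stable_subspace (calculus f) \<and>
      {v. R *v v = 0} = unstable_subspace (calculus f)"
  \<comment> \<open>A projection is determined by its range and kernel: \<open>R\<close> fixes
    \<open>?Q *v v\<close>, which lies in its range, and kills the remainder, which lies in its
    kernel.\<close>
  have "R *v v = ?Q *v v" for v
  proof -
    obtain w where "?Q *v v = R *v w"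
      using R range(1) by blast
    then have "R *v (?Q *v v) = ?Q *v v"
      using R by (simp add: matrix_vector_mul_assoc)
    moreover have "v - ?Q *v v \<in> {v. R *v v = 0}"
      using R range(2) unfolding U_v by blast
    ultimately show ?thesis
      by (simp add: matrix_vector_mult_diff_distrib)
  qed
  then show "R = ?Q"
    by (simp add: matrix_eq)
qed

lemma bounded_lipschitz_calculus:
  assumes "\<And>i. bounded_lipschitz (\<lambda>x. f x i)"
  shows "bounded_lipschitz (\<lambda>x. calculus (f x))"
  unfolding calculus_def
  by (rule weighted_lipschitz_sum, simp)
    (rule weighted_lipschitz_bilinear[OF _ bounded_bilinear_cscale assms], simp_all)

end

section \<open>Block matrices and the spectral resolution of the companion matrix\<close>

lemma blk_mult:
  fixes A B C D :: "'a::semiring_1^2^2"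
  shows "blk A B C D ** blk A' B' C' D'
    = blk (A ** A' + B ** C') (A ** B' + B ** D') (C ** A' + D ** C') (C ** B' + D ** D')"
  by (simp add: vec_eq_iff blk_def matrix_matrix_mult_def UNIV_Plus_UNIV[symmetric] sum.Plus
      split: sum.split del: UNIV_Plus_UNIV)

lemma blk_add: "blk A B C D + blk A' B' C' D' = blk (A + A') (B + B') (C + C') (D + D')"
  for A :: "'a::monoid_add^2^2"
  by (simp add: vec_eq_iff blk_def split: sum.split)

lemma cscale_blk: "cscale z (blk A B C D) = blk (cscale z A) (cscale z B) (cscale z C) (cscale z D)"
  by (simp add: vec_eq_iff blk_def split: sum.split)

lemma mat_blk: "mat z = blk (mat z) 0 0 (mat z)"
  by (simp add: vec_eq_iff blk_def mat_def split: sum.split)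

lemma blk_zero: "blk 0 0 0 0 = 0"
  by (simp add: vec_eq_iff blk_def split: sum.split)

definition pm :: "bool \<Rightarrow> complex" where
  "pm \<sigma> = (if \<sigma> then 1 else -1)"

lemma pm_simps [simp]: "pm True = 1" "pm False = -1"
  by (simp_all add: pm_def)

text \<open>The eigenprojections of the matrices \<^term>\<open>rotm a b\<close>, onto the lines spanned by \<open>(1, \<mp>\<i>)\<close>.\<close>

definition rot_proj :: "bool \<Rightarrow> complex^2^2" where
  "rot_proj \<sigma> = m2 (1/2) (pm \<sigma> * \<i> / 2) (- pm \<sigma> * \<i> / 2) (1/2)"

interpretation rot: spectral_resolution rot_proj
proof
  show "rot_proj i ** rot_proj j = (if i = j then rot_proj i else 0)" for i j
    by (cases i; cases j) (simp_all add: rot_proj_def matrix_2_simps)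
  show "(\<Sum>i\<in>UNIV. rot_proj i) = mat 1"
    by (simp add: rot_proj_def matrix_2_simps UNIV_bool)
qed

lemma cmat_rotm: "cmat (rotm a b) = rot.calculus (\<lambda>\<sigma>. of_real a + pm \<sigma> * \<i> * of_real b)"
  by (simp add: rot.calculus_def UNIV_bool rot_proj_def rotm_def cmat_def vec_eq_iff forall_2
      field_simps)

text \<open>The inverse is again of the form \<open>rotm\<close>, so the inverse of B and N_0 are
  diagonalised by the same projections \<open>rot_proj\<close>.\<close>

lemma cmat_matrix_inv_rotm:
  assumes "(a, b) \<noteq> (0, 0)"
  shows "cmat (matrix_inv (rotm a b)) = rot.calculus (\<lambda>\<sigma>. 1 / (of_real a + pm \<sigma> * \<i> * of_real b))"
proof -
  define n where "n = a\<^sup>2 + b\<^sup>2"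
  have n: "n \<noteq> 0"
    using assms by (auto simp: n_def sum_power2_eq_zero_iff)
  have "det (rotm a b) = n"
    by (simp add: det_2 rotm_def n_def power2_eq_square)
  then have "matrix_inv (rotm a b) = rotm (a / n) (- b / n)"
    using n by (simp add: matrix_inv_2 adj_2_def) (simp add: rotm_def vec_eq_iff forall_2)
  moreover have "of_real (a / n) + pm \<sigma> * \<i> * of_real (- b / n) = 1 / (of_real a + pm \<sigma> * \<i> * of_real b)" for \<sigma>
  proof -
    have "(of_real a + pm \<sigma> * \<i> * of_real b) * (of_real a - pm \<sigma> * \<i> * of_real b) = (of_real n :: complex)"
      by (cases \<sigma>) (simp_all add: n_def power2_eq_square algebra_simps)
    moreover from this have "of_real a + pm \<sigma> * \<i> * of_real b \<noteq> 0"
      using n by auto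
    ultimately show ?thesis
      using n by (simp add: field_simps)
  qed
  ultimately show ?thesis
    by (simp only: cmat_rotm)
qed

text \<open>The companion matrix of \<open>v'' = W v\<close>: an eigenvector \<open>v\<close> of \<open>W\<close> for \<open>k\<^sup>2\<close> yields the
  eigenvectors \<open>(v, \<plusminus>k v)\<close> for \<open>\<plusminus>k\<close>.\<close>

definition companion_proj :: "(bool \<Rightarrow> complex) \<Rightarrow> bool \<times> bool \<Rightarrow> complex^idx4^idx4" where
  "companion_proj k = (\<lambda>(\<sigma>, \<tau>). blk (cscale (1/2) (rot_proj \<sigma>)) (cscale (pm \<tau> / (2 * k \<sigma>)) (rot_proj \<sigma>))
      (cscale (pm \<tau> * k \<sigma> / 2) (rot_proj \<sigma>)) (cscale (1/2) (rot_proj \<sigma>)))"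

lemma sum_bool_bool:
  fixes g :: "bool \<times> bool \<Rightarrow> 'a::comm_monoid_add"
  shows "(\<Sum>p\<in>UNIV. g p) = (\<Sum>\<sigma>\<in>UNIV. g (\<sigma>, True) + g (\<sigma>, False))"
proof -
  have "(\<Sum>p\<in>UNIV. g p) = (\<Sum>\<sigma>\<in>UNIV. \<Sum>\<tau>\<in>UNIV. g (\<sigma>, \<tau>))"
    by (simp add: sum.cartesian_product)
  then show ?thesis
    by (simp add: UNIV_bool add.commute)
qed

text \<open>On each eigenline of \<open>rot_proj\<close> the matrix reduces to the 2x2 matrix with
  rows (0, 1) and (k^2, 0). Its eigenvalues k and -k are distinct because k is nonzero, and the
  blocks hold its two spectral projections.\<close>

lemma companion_resolution:
  assumes k: "\<And>\<sigma>. k \<sigma> \<noteq> 0"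
  shows "spectral_resolution (companion_proj k)"
    and "blk 0 (mat 1) (rot.calculus (\<lambda>\<sigma>. (k \<sigma>)\<^sup>2)) 0
      = spectral_resolution.calculus (companion_proj k) (\<lambda>(\<sigma>, \<tau>). pm \<tau> * k \<sigma>)"
proof -
  have cscale_sum: "cscale z A + cscale w A = cscale (z + w) A" for z w and A :: "complex^2^2"
    by (simp add: cscale_add_left)
  have blk_sum: "(\<Sum>\<sigma>\<in>UNIV. blk (A \<sigma>) (B \<sigma>) (C \<sigma>) (E \<sigma>))
      = blk (\<Sum>\<sigma>\<in>UNIV. A \<sigma>) (\<Sum>\<sigma>\<in>UNIV. B \<sigma>) (\<Sum>\<sigma>\<in>UNIV. C \<sigma>) (\<Sum>\<sigma>\<in>UNIV. E \<sigma>)"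
    for A B C E :: "bool \<Rightarrow> complex^2^2"
    by (simp add: UNIV_bool blk_add)
  show res: "spectral_resolution (companion_proj k)"
  proof
    fix i j :: "bool \<times> bool"
    obtain \<sigma> \<tau> \<sigma>' \<tau>' where ij: "i = (\<sigma>, \<tau>)" "j = (\<sigma>', \<tau>')"
      by (metis surj_pair)
    \<comment> \<open>The four block coefficients of a product of two projections sharing the same
      \<open>\<sigma>\<close>.\<close>
    have *: "pm \<tau> * k \<sigma> / 2 * (1 / 2) + 1 / 2 * (pm \<tau>' * k \<sigma> / 2) = (if \<tau> = \<tau>' then pm \<tau> * k \<sigma> / 2 else 0)"
      "1 / 2 * (pm \<tau>' / (2 * k \<sigma>)) + pm \<tau> / (2 * k \<sigma>) * (1 / 2) = (if \<tau> = \<tau>' then pm \<tau> / (2 * k \<sigma>) else 0)"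
      "1 / 2 * (1 / 2) + pm \<tau> / (2 * k \<sigma>) * (pm \<tau>' * k \<sigma> / 2) = (if \<tau> = \<tau>' then 1 / 2 else 0)"
      "pm \<tau> * k \<sigma> / 2 * (pm \<tau>' / (2 * k \<sigma>)) + 1 / 2 * (1 / 2) = (if \<tau> = \<tau>' then 1 / 2 else 0)"
      using k[of \<sigma>] by (cases \<tau>; cases \<tau>'; simp add: field_simps)+
    show "companion_proj k i ** companion_proj k j = (if i = j then companion_proj k i else 0)"
    proof (cases "\<sigma> = \<sigma>'")
      case True
      then show ?thesis
        unfolding ij companion_proj_def prod.case blk_mult cscale_mult rot.orthogonal cscale_sum
        using * by (simp del: times_divide_eq_left times_divide_eq_right add: blk_zero)
    qed (simp add: ij companion_proj_def blk_mult cscale_mult rot.orthogonal blk_zero)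
  next
    show "(\<Sum>i\<in>UNIV. companion_proj k i) = mat 1"
      unfolding sum_bool_bool companion_proj_def prod.case blk_add cscale_sum blk_sum
      by (simp add: rot.complete flip: mat_blk)
  qed
  show "blk 0 (mat 1) (rot.calculus (\<lambda>\<sigma>. (k \<sigma>)\<^sup>2)) 0
      = spectral_resolution.calculus (companion_proj k) (\<lambda>(\<sigma>, \<tau>). pm \<tau> * k \<sigma>)"
    unfolding spectral_resolution.calculus_def[OF res] rot.calculus_def
    unfolding sum_bool_bool companion_proj_def prod.case cscale_blk blk_add blk_sum
    using k by (simp add: vec_eq_iff blk_def rot.complete[symmetric] power2_eq_square algebra_simps split: sum.split)
qed

section \<open>The kernel\<close>

text \<open>The half plane is convex and the derivative of \<open>exp\<close> has modulus at most 1
  there.\<close>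

lemma exp_lipschitz_left_half_plane:
  fixes z w :: complex
  assumes "Re z \<le> 0" "Re w \<le> 0"
  shows "norm (exp z - exp w) \<le> norm (z - w)"
proof -
  have "norm (exp z - exp w) \<le> 1 * norm (z - w)"
    by (rule field_differentiable_bound[OF convex_halfspace_Re_le[of 0], of exp exp])
      (use assms in \<open>auto intro: derivative_eq_intros\<close>)
  then show ?thesis
    by simp
qed

text \<open>\<open>h\<close> will be time clipped at zero: \<open>max t 0\<close> for decaying modes
  and \<open>min t 0\<close> for growing ones. Clipping keeps the exponent in the left half plane
  for all times.\<close>

lemma bounded_lipschitz_exp:
  assumes h: "\<And>t. Re (of_real (h t) * \<kappa>) \<le> 0" and lip: "1-lipschitz_on UNIV h"
  shows "bounded_lipschitz (\<lambda>t. exp (of_real (h t) * \<kappa> :: complex))"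
proof (rule weighted_lipschitzI)
  show "norm (exp (of_real (h t) * \<kappa>)) \<le> 1" for t
    using h[of t] by (simp add: norm_exp_eq_Re)
  fix s t
  have "norm (exp (of_real (h s) * \<kappa>) - exp (of_real (h t) * \<kappa>)) \<le> norm (of_real (h s - h t) * \<kappa>)"
    using exp_lipschitz_left_half_plane[OF h[of s] h[of t]] by (simp add: algebra_simps)
  also have "\<dots> \<le> norm \<kappa> * dist s t"
    using lipschitz_onD[OF lip, of s t] unfolding norm_mult norm_of_real
    by (simp add: dist_real_def mult.commute mult_left_mono)
  finally show "1 * norm (exp (of_real (h s) * \<kappa>) - exp (of_real (h t) * \<kappa>)) \<le> norm \<kappa> * dist s t"
    by simp
qed

text \<open>The right factor has values in the lower half of the components, which the left factor
  annihilates. \<open>M\<close> and \<open>N\<close> are independent because the kernel evaluates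
  them at different points.\<close>

lemma cgl_Rr_mult_cgl_Rl: "cgl_Rr M ** cgl_Rl B N = 0"
  by (simp add: cgl_Rr_def cgl_Rl_def blk_mult blk_zero)

context spectral_resolution
begin

text \<open>Adding the constant \<open>- I\<close> for \<open>t \<ge> 0\<close> removes the jump of the Green's function at \<open>t = 0\<close>; it is
  invisible in the kernel because \<open>R\<^sub>r R\<^sub>\<ell> = 0\<close>.\<close>

definition green :: "('i \<Rightarrow> complex) \<Rightarrow> real \<Rightarrow> complex^'n^'n" where
  "green f t = calculus (\<lambda>i. if Re (f i) < 0 then exp (of_real (max t 0) * f i) - 1
                              else - exp (of_real (min t 0) * f i))"

lemma bounded_lipschitz_green: "bounded_lipschitz (green f)"
  unfolding green_def
proof (rule bounded_lipschitz_calculus)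
  fix i
  have "1-lipschitz_on UNIV (\<lambda>t. max t (0::real))" "1-lipschitz_on UNIV (\<lambda>t. min t (0::real))"
    by (auto intro!: lipschitz_onI simp: dist_real_def)
  then show "bounded_lipschitz (\<lambda>t. if Re (f i) < 0 then exp (of_real (max t 0) * f i) - 1
                              else - exp (of_real (min t 0) * f i))"
    by (cases "Re (f i) < 0")
      (auto intro!: weighted_lipschitz_diff weighted_lipschitz_minus bounded_lipschitz_exp
        simp: mult_le_0_iff)
qed

end

locale spectral_resolution_4 = spectral_resolution P for P :: "'i::finite \<Rightarrow> complex^idx4^idx4"
begin

lemma cgl_K_green:
  assumes hyperbolic: "\<And>i. Re (f i) \<noteq> 0"
    and orth: "\<And>x y. Rr x ** Rl y = 0"
  shows "cgl_K Rr Rl (calculus f) (x, y) = - (Rr x ** green f (x - y) ** Rl y)"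
proof (cases "y \<le> x")
  case True
  let ?Q = "calculus (\<lambda>i. of_bool (Re (f i) < 0))" and ?E = "calculus (\<lambda>i. exp (of_real (x - y) * f i))"
  \<comment> \<open>For nonnegative time the clipped exponential of an unstable mode is 1, so every
    mode carries the same extra -1.\<close>
  have "green f (x - y) = calculus (\<lambda>i. of_bool (Re (f i) < 0) * exp (of_real (x - y) * f i)
      * of_bool (Re (f i) < 0) - 1)"
    unfolding green_def using True by (intro arg_cong[of _ _ calculus] ext) auto
  then have "green f (x - y) = ?Q ** ?E ** ?Q - mat 1"
    by (simp add: calculus_diff calculus_const calculus_mult)
  then have "Rr x ** green f (x - y) ** Rl y = Rr x ** (?Q ** ?E ** ?Q) ** Rl y"
    by (simp add: bounded_bilinear.diff_right[OF bounded_bilinear_matrix_mult]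
        bounded_bilinear.diff_left[OF bounded_bilinear_matrix_mult] orth)
  then show ?thesis
    using True by (simp add: cgl_K_def Let_def stable_proj_calculus[OF hyperbolic] calculus_scaleR
        mexp_calculus matrix_mul_assoc)
next
  case False
  let ?Q = "calculus (\<lambda>i. 1 - of_bool (Re (f i) < 0))" and ?E = "calculus (\<lambda>i. exp (of_real (x - y) * f i))"
  \<comment> \<open>For negative time a stable mode contributes \<open>exp 0 - 1 = 0\<close>,
    leaving only the unstable ones.\<close>
  have "green f (x - y) = calculus (\<lambda>i. - ((1 - of_bool (Re (f i) < 0)) * exp (of_real (x - y) * f i)
      * (1 - of_bool (Re (f i) < 0))))"
    unfolding green_def using False by (intro arg_cong[of _ _ calculus] ext) (auto simp: max_def min_def)
  then have "green f (x - y) = - (?Q ** ?E ** ?Q)"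
    by (simp add: calculus_minus calculus_mult)
  then have "- (Rr x ** green f (x - y) ** Rl y) = Rr x ** (?Q ** ?E ** ?Q) ** Rl y"
    by (simp add: bounded_bilinear.minus_right[OF bounded_bilinear_matrix_mult]
        bounded_bilinear.minus_left[OF bounded_bilinear_matrix_mult])
  moreover have "?Q = mat 1 - calculus (\<lambda>i. of_bool (Re (f i) < 0))"
    by (simp only: calculus_diff calculus_const)
  ultimately show ?thesis
    using False by (simp add: cgl_K_def Let_def stable_proj_calculus[OF hyperbolic] calculus_scaleR
        mexp_calculus matrix_mul_assoc)
qed

lemma lipschitz_cgl_K:
  assumes hyperbolic: "\<And>i. Re (f i) \<noteq> 0"
    and orth: "\<And>x y. Rr x ** Rl y = 0"
    and Rr: "bounded_lipschitz Rr" and Rl: "bounded_lipschitz Rl"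
  shows "\<exists>L. L-lipschitz_on UNIV (cgl_K Rr Rl (calculus f))"
proof (rule bounded_lipschitz_imp_lipschitz)
  have lip: "1-lipschitz_on UNIV (fst :: real \<times> real \<Rightarrow> real)" "1-lipschitz_on UNIV (snd :: real \<times> real \<Rightarrow> real)"
    by (intro lipschitz_onI; simp add: dist_fst_le dist_snd_le)+
  have lip2: "(1 + 1)-lipschitz_on UNIV (\<lambda>p :: real \<times> real. fst p - snd p)"
    by (intro lipschitz_on_diff lip)
  have "bounded_lipschitz (\<lambda>p. - (Rr (fst p) ** green f (fst p - snd p) ** Rl (snd p)))"
    by (rule weighted_lipschitz_minus, simp)
      (intro weighted_lipschitz_matrix_mult bounded_lipschitz_compose[OF Rr lip(1)]
        bounded_lipschitz_compose[OF Rl lip(2)] bounded_lipschitz_compose[OF bounded_lipschitz_green lip2]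
        zero_le_one)
  also have "(\<lambda>p. - (Rr (fst p) ** green f (fst p - snd p) ** Rl (snd p))) = cgl_K Rr Rl (calculus f)"
    by (auto simp: fun_eq_iff cgl_K_green[OF hyperbolic orth])
  finally show "bounded_lipschitz (cgl_K Rr Rl (calculus f))" .
qed

end

section \<open>Hyperbolicity of the asymptotic matrix off the essential spectrum\<close>

lemma cgl_Ainf_resolution:
  assumes "(D, \<beta>) \<noteq> (0, 0)" and lam: "lam \<notin> ess_spec D \<beta> \<delta> \<alpha>"
  obtains P :: "bool \<times> bool \<Rightarrow> complex^idx4^idx4" and f
  where "spectral_resolution P"
    and "cgl_Ainf (cgl_B D \<beta>) (rotm \<delta> \<alpha>) lam = spectral_resolution.calculus P f"
    and "\<And>i. Re (f i) \<noteq> 0"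
proof -
  define b where "b \<sigma> = of_real \<beta> + pm \<sigma> * \<i> * of_real (D / 2)" for \<sigma>
  define n where "n \<sigma> = of_real \<delta> + pm \<sigma> * \<i> * of_real \<alpha>" for \<sigma>
  \<comment> \<open>\<open>b\<close> and \<open>n\<close> are the eigenvalues of B and N_0. The
    choice of the root is immaterial, as both signs of \<open>k\<close> occur in the
    spectrum.\<close>
  define k where "k \<sigma> = csqrt ((lam - n \<sigma>) / b \<sigma>)" for \<sigma>
  have b: "b \<sigma> \<noteq> 0" for \<sigma>
    using assms(1) by (cases \<sigma>) (auto simp: b_def complex_eq_iff)
  have k2: "(k \<sigma>)\<^sup>2 = 1 / b \<sigma> * (lam - n \<sigma>)" for \<sigma>
    by (simp add: k_def)
  \<comment> \<open>A purely imaginary \<open>k \<sigma>\<close>, equal to i y, would place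
    \<open>lam\<close> on the essential spectrum at parameter s = y.\<close>
  have Re_k: "Re (k \<sigma>) \<noteq> 0" for \<sigma>
  proof
    assume "Re (k \<sigma>) = 0"
    then obtain y where y: "k \<sigma> = \<i> * of_real y"
      using that[of "Im (k \<sigma>)"] by (simp add: complex_eq_iff)
    have "(k \<sigma>)\<^sup>2 = - of_real (y\<^sup>2)"
      by (simp add: y power_mult_distrib)
    then have "lam = n \<sigma> - of_real (y\<^sup>2) * b \<sigma>"
      using k2[of \<sigma>] b[of \<sigma>] by (simp add: field_simps)
    moreover have "n True = Complex \<delta> \<alpha>" "n False = Complex \<delta> (- \<alpha>)"
      "b True = Complex \<beta> (D / 2)" "b False = Complex \<beta> (- D / 2)"
      by (simp_all add: n_def b_def complex_eq_iff)
    ultimately show False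
      using lam by (cases \<sigma>) (auto simp: ess_spec_def)
  qed
  have k: "k \<sigma> \<noteq> 0" for \<sigma>
    using Re_k[of \<sigma>] by auto
  have B: "cgl_B D \<beta> = rotm \<beta> (D / 2)"
    by (simp add: cgl_B_def rotm_def)
  have nz: "(\<beta>, D / 2) \<noteq> (0, 0)"
    using assms(1) by auto
  have "cmat (matrix_inv (cgl_B D \<beta>)) ** (mat lam - cmat (rotm \<delta> \<alpha>))
      = rot.calculus (\<lambda>\<sigma>. 1 / b \<sigma>) ** (rot.calculus (\<lambda>_. lam) - rot.calculus n)"
    by (simp only: B cmat_matrix_inv_rotm[OF nz] cmat_rotm rot.calculus_const b_def[abs_def] n_def[abs_def])
  also have "\<dots> = rot.calculus (\<lambda>\<sigma>. (k \<sigma>)\<^sup>2)"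
    unfolding rot.calculus_diff[symmetric] rot.calculus_mult k2 ..
  finally have "cgl_Ainf (cgl_B D \<beta>) (rotm \<delta> \<alpha>) lam
      = spectral_resolution.calculus (companion_proj k) (\<lambda>(\<sigma>, \<tau>). pm \<tau> * k \<sigma>)"
    unfolding cgl_Ainf_def by (simp only: companion_resolution(2)[OF k])
  moreover have "Re ((\<lambda>(\<sigma>, \<tau>). pm \<tau> * k \<sigma>) i) \<noteq> 0" for i
    using Re_k by (auto simp: pm_def split: prod.split)
  ultimately show thesis
    by (rule that[OF companion_resolution(1)[OF k]])
qed

section \<open>Choice of the weight along the pulse\<close>

lemma cgl_R_pulse:
  fixes \<psi> \<psi>' :: "real \<Rightarrow> complex"
  assumes d1: "\<And>x. (\<psi> has_vector_derivative \<psi>' x) (at x)"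
    and "\<eta> > 0" and decay: "\<And>x. norm (\<psi> x) \<le> C * exp (- \<eta> * \<bar>x\<bar>)" "\<And>x. norm (\<psi>' x) \<le> C * exp (- \<eta> * \<bar>x\<bar>)"
    and detM: "\<And>x. det (cgl_M \<epsilon> \<gamma> \<mu> \<nu> (\<psi> x)) \<noteq> 0"
  shows "bounded_lipschitz (\<lambda>x. cgl_Rr (cgl_M \<epsilon> \<gamma> \<mu> \<nu> (\<psi> x)))"
    and "bounded_lipschitz (\<lambda>x. cgl_Rl B (cgl_M \<epsilon> \<gamma> \<mu> \<nu> (\<psi> x)))"
proof -
  define s where "s x = (cmod (\<psi> x))\<^sup>2" for x
  \<comment> \<open>M vanishes at a zero of psi, which invertibility excludes; hence the direction
    of psi is defined everywhere.\<close>
  have nz: "\<psi> x \<noteq> 0" for x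
  proof
    assume "\<psi> x = 0"
    then have "det (0 :: real^2^2) \<noteq> 0"
      using detM[of x] by (simp only: cgl_M_0 not_False_eq_True)
    then show False
      by (simp add: det_2)
  qed
  have "0 \<le> C"
    using order_trans[OF norm_ge_zero decay(1)[of 0]] by simp
  have "C * exp (- \<eta> * \<bar>x\<bar>) \<le> C" for x
    using mult_left_mono[OF _ \<open>0 \<le> C\<close>, of "exp (- \<eta> * \<bar>x\<bar>)" 1] \<open>\<eta> > 0\<close> by simp
  then have le_C: "norm (\<psi> x) \<le> C" "norm (\<psi>' x) \<le> C" for x
    by (rule order_trans[OF decay(1)], rule order_trans[OF decay(2)])
  have \<psi>: "bounded_lipschitz \<psi>"
  proof (rule weighted_lipschitzI[OF le_C(1)])
    fix x y
    have "norm (\<psi> x - \<psi> y) \<le> C * norm (x - y)"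
    proof (rule differentiable_bound[OF convex_UNIV])
      show "(\<psi> has_derivative (\<lambda>h. h *\<^sub>R \<psi>' t)) (at t within UNIV)" for t
        using d1[of t] by (simp add: has_vector_derivative_def)
      show "onorm (\<lambda>h. h *\<^sub>R \<psi>' t) \<le> C" for t
        using mult_right_mono[OF le_C(2)[of t] abs_ge_zero]
        by (intro onorm_le) (simp add: mult.commute)
    qed simp_all
    then show "1 * norm (\<psi> x - \<psi> y) \<le> C * dist x y"
      by (simp add: dist_norm)
  qed
  have r: "bounded_lipschitz (\<lambda>x. cmod (\<psi> x))"
    by (rule weighted_lipschitz_dominated[OF \<psi>, of _ C 1]) (simp_all add: le_C norm_triangle_ineq3)
  then have s: "bounded_lipschitz s"
    unfolding s_def[abs_def] by (intro weighted_lipschitz_power zero_le_one)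
  have proj: "weighted_lipschitz (\<lambda>x. cmod (\<psi> x)) (\<lambda>x. radial_proj (\<psi> x))"
    by (rule weighted_lipschitz_radial_proj[OF nz \<psi>])
  have M: "cgl_M \<epsilon> \<gamma> \<mu> \<nu> (\<psi> x) = s x *\<^sub>R (rotm (\<epsilon> + s x * \<mu>) (\<gamma> + s x * \<nu>)
      + rotm (2 * \<epsilon> + 4 * s x * \<mu>) (2 * \<gamma> + 4 * s x * \<nu>) ** radial_proj (\<psi> x))" for x
    by (rule cgl_M_eq[OF nz s_def])
  \<comment> \<open>If N_1 = 0, the matrix left after extracting one factor \<open>s x\<close> still
    tends to zero at infinity, so a second factor must be extracted.\<close>
  consider (cubic) "(\<epsilon>, \<gamma>) \<noteq> (0, 0)" | (quintic) "\<epsilon> = 0" "\<gamma> = 0"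
    by auto
  then have "\<exists>\<rho> G c. (\<forall>x. 0 < \<rho> x) \<and> bounded_lipschitz \<rho> \<and> (\<forall>x. cgl_M \<epsilon> \<gamma> \<mu> \<nu> (\<psi> x) = (\<rho> x)\<^sup>2 *\<^sub>R G x)
      \<and> weighted_lipschitz \<rho> G \<and> 0 < c \<and> (\<forall>x. c \<le> \<bar>det (G x)\<bar>)"
  proof cases
    case cubic
    let ?G = "\<lambda>x. rotm (\<epsilon> + s x * \<mu>) (\<gamma> + s x * \<nu>)
        + rotm (2 * \<epsilon> + 4 * s x * \<mu>) (2 * \<gamma> + 4 * s x * \<nu>) ** radial_proj (\<psi> x)"
    let ?d = "\<lambda>x. (\<epsilon> + s x * \<mu>)\<^sup>2 + (\<gamma> + s x * \<nu>)\<^sup>2 + (\<epsilon> + s x * \<mu>) * (2 * \<epsilon> + 4 * s x * \<mu>)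
        + (\<gamma> + s x * \<nu>) * (2 * \<gamma> + 4 * s x * \<nu>)"
    have det: "det (?G x) = ?d x" for x
      by (rule det_rotm_radial_proj[OF nz])
    have "continuous_on UNIV \<psi>"
      using d1 by (intro continuous_at_imp_continuous_on ballI has_vector_derivative_continuous)
    then have cont: "continuous_on UNIV s"
      unfolding s_def[abs_def] by (intro continuous_intros)
    have "((\<lambda>x. C * exp (- \<eta> * norm x)) \<longlongrightarrow> C * 0) (at_infinity :: real filter)"
      using \<open>\<eta> > 0\<close>
      by (intro tendsto_mult tendsto_const filterlim_compose[OF exp_at_bot]
          filterlim_tendsto_neg_mult_at_bot[OF tendsto_const _ filterlim_norm_at_top]) simp
    then have "(\<psi> \<longlongrightarrow> 0) at_infinity"
      using decay(1) by (intro Lim_null_comparison[of \<psi> "\<lambda>x. C * exp (- \<eta> * norm x)"]) simp_all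
    then have "(s \<longlongrightarrow> 0) at_infinity"
      unfolding s_def[abs_def] using tendsto_power[OF tendsto_norm_zero, of \<psi> at_infinity 2] by simp
    \<comment> \<open>The determinant depends on \<open>s x\<close> alone, hence has a limit even if
      the direction of psi has none. The limit is three times det N_1.\<close>
    then have "(?d \<longlongrightarrow> (\<epsilon> + 0 * \<mu>)\<^sup>2 + (\<gamma> + 0 * \<nu>)\<^sup>2 + (\<epsilon> + 0 * \<mu>) * (2 * \<epsilon> + 4 * 0 * \<mu>)
        + (\<gamma> + 0 * \<nu>) * (2 * \<gamma> + 4 * 0 * \<nu>)) at_infinity"
      by (intro tendsto_intros)
    also have "(\<epsilon> + 0 * \<mu>)\<^sup>2 + (\<gamma> + 0 * \<nu>)\<^sup>2 + (\<epsilon> + 0 * \<mu>) * (2 * \<epsilon> + 4 * 0 * \<mu>)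
        + (\<gamma> + 0 * \<nu>) * (2 * \<gamma> + 4 * 0 * \<nu>) = 3 * (\<epsilon>\<^sup>2 + \<gamma>\<^sup>2)"
      by (simp add: power2_eq_square)
    finally have lim: "(?d \<longlongrightarrow> 3 * (\<epsilon>\<^sup>2 + \<gamma>\<^sup>2)) at_infinity" .
    have d_nz: "?d x \<noteq> 0" for x
      using detM[of x] unfolding M det_scaleR_2 det by simp
    have d_cont: "continuous_on UNIV ?d"
      by (intro continuous_intros cont)
    have l_nz: "3 * (\<epsilon>\<^sup>2 + \<gamma>\<^sup>2) \<noteq> 0"
      using cubic by (simp add: sum_power2_eq_zero_iff del: distrib_left_numeral)
    obtain c where c: "0 < c" "\<And>x. c \<le> \<bar>?d x\<bar>"
      by (rule bounded_away_from_zero[OF d_cont lim l_nz d_nz]) (rule that; assumption)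
    have ws: "weighted_lipschitz (\<lambda>x. cmod (\<psi> x)) s"
      by (rule weighted_lipschitz_weight_mono[OF s, of _ C]) (simp_all add: le_C)
    have "weighted_lipschitz (\<lambda>x. cmod (\<psi> x)) (\<lambda>x. (rotm \<epsilon> \<gamma> + s x *\<^sub>R rotm \<mu> \<nu>)
        + (rotm (2 * \<epsilon>) (2 * \<gamma>) + s x *\<^sub>R rotm (4 * \<mu>) (4 * \<nu>)) ** radial_proj (\<psi> x))"
      by (intro weighted_lipschitz_add weighted_lipschitz_matrix_mult weighted_lipschitz_scaleR
          weighted_lipschitz_const proj ws norm_ge_zero)
    then have G: "weighted_lipschitz (\<lambda>x. cmod (\<psi> x)) ?G"
      by (simp add: rotm_add rotm_scaleR mult_ac)
    show ?thesis
    proof (intro exI conjI allI)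
      show "cgl_M \<epsilon> \<gamma> \<mu> \<nu> (\<psi> x) = (cmod (\<psi> x))\<^sup>2 *\<^sub>R ?G x" for x
        using M[of x] by (simp only: s_def)
      show "c \<le> \<bar>det (?G x)\<bar>" for x
        unfolding det by (rule c)
    qed (use nz r G c in simp_all)
  next
    case quintic
    let ?G = "\<lambda>x. rotm \<mu> \<nu> + rotm (4 * \<mu>) (4 * \<nu>) ** radial_proj (\<psi> x)"
    \<comment> \<open>Here the determinant is constant: the factor is 1 + 4, the 4 coming from the
      radial term.\<close>
    let ?c = "5 * (\<mu>\<^sup>2 + \<nu>\<^sup>2)"
    have det: "det (?G x) = ?c" for x
      by (simp add: det_rotm_radial_proj[OF nz] power2_eq_square)
    have "rotm (\<epsilon> + s x * \<mu>) (\<gamma> + s x * \<nu>) = s x *\<^sub>R rotm \<mu> \<nu>"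
      "rotm (2 * \<epsilon> + 4 * s x * \<mu>) (2 * \<gamma> + 4 * s x * \<nu>) = s x *\<^sub>R rotm (4 * \<mu>) (4 * \<nu>)" for x
      by (simp_all add: quintic rotm_scaleR mult_ac)
    then have M': "cgl_M \<epsilon> \<gamma> \<mu> \<nu> (\<psi> x) = (s x)\<^sup>2 *\<^sub>R ?G x" for x
      unfolding M by (simp only: scalar_matrix_assoc[symmetric] scaleR_add_right[symmetric]
          scaleR_scaleR power2_eq_square)
    then have "?c \<noteq> 0"
      using detM[of 0] by (auto simp: det_scaleR_2 det)
    then have c: "0 < ?c"
      by (simp add: order_less_le del: distrib_left_numeral)
    have s_nonneg: "0 \<le> s x" for x
      by (simp add: s_def)
    \<comment> \<open>The squared modulus is at most \<open>C\<close> times the modulus, so the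
      weight may be lowered.\<close>
    have ws: "weighted_lipschitz s (\<lambda>x. radial_proj (\<psi> x))"
      by (rule weighted_lipschitz_weight_mono[OF proj, of _ C])
        (simp_all add: s_def power2_eq_square mult_right_mono le_C)
    have "weighted_lipschitz s ?G"
      by (intro weighted_lipschitz_add weighted_lipschitz_matrix_mult weighted_lipschitz_const
          s_nonneg ws)
    then show ?thesis
    proof (intro exI conjI allI)
      show "0 < s x" for x
        using nz by (simp add: s_def)
      show "cgl_M \<epsilon> \<gamma> \<mu> \<nu> (\<psi> x) = (s x)\<^sup>2 *\<^sub>R ?G x" for x
        by (rule M')
      show "?c \<le> \<bar>det (?G x)\<bar>" for x
        unfolding det by simp
    qed (use s c in simp_all)
  qed
  then obtain \<rho> G c where *: "\<And>x. 0 < \<rho> x" "bounded_lipschitz \<rho>"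
      "\<And>x. cgl_M \<epsilon> \<gamma> \<mu> \<nu> (\<psi> x) = (\<rho> x)\<^sup>2 *\<^sub>R G x"
      "weighted_lipschitz \<rho> G" "0 < c" "\<And>x. c \<le> \<bar>det (G x)\<bar>"
    by blast
  show "bounded_lipschitz (\<lambda>x. cgl_Rr (cgl_M \<epsilon> \<gamma> \<mu> \<nu> (\<psi> x)))"
    and "bounded_lipschitz (\<lambda>x. cgl_Rl B (cgl_M \<epsilon> \<gamma> \<mu> \<nu> (\<psi> x)))"
    by (rule bounded_lipschitz_cgl_R[OF *])+
qed

theorem theorem7p3:
  fixes D \<beta> \<delta> \<alpha> \<epsilon> \<gamma> \<mu> \<nu> :: real
    and \<psi> \<psi>' \<psi>'' :: "real \<Rightarrow> complex"
    and lam :: complex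
  assumes beta: "\<beta> \<ge> 0" and Dbeta: "(D, \<beta>) \<noteq> (0, 0)"
    and d1: "\<And>x. (\<psi> has_vector_derivative \<psi>' x) (at x)"
    and d2: "\<And>x. (\<psi>' has_vector_derivative \<psi>'' x) (at x)"
    and pulse: "\<And>x. of_real \<alpha> * \<psi> x + of_real (D/2) * \<psi>'' x
                   + of_real \<gamma> * (of_real (cmod (\<psi> x)))\<^sup>2 * \<psi> x
                   + of_real \<nu> * (of_real (cmod (\<psi> x)))^4 * \<psi> x
              = \<i> * of_real \<delta> * \<psi> x + \<i> * of_real \<epsilon> * (of_real (cmod (\<psi> x)))\<^sup>2 * \<psi> x
                   + \<i> * of_real \<beta> * \<psi>'' x + \<i> * of_real \<mu> * (of_real (cmod (\<psi> x)))^4 * \<psi> x"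
    and C1: "continuous_on UNIV \<psi>'"
    and decay: "\<exists>C \<eta>. \<eta> > 0 \<and> (\<forall>x. norm (\<psi> x) \<le> C * exp (- \<eta> * \<bar>x\<bar>)
                                 \<and> norm (\<psi>' x) \<le> C * exp (- \<eta> * \<bar>x\<bar>))"
    and detM: "\<And>x. det (cgl_M \<epsilon> \<gamma> \<mu> \<nu> (\<psi> x)) \<noteq> 0"
    and lam: "lam \<notin> ess_spec D \<beta> \<delta> \<alpha>"
  shows "\<exists>L. L-lipschitz_on UNIV
           (cgl_K (\<lambda>x. cgl_Rr (cgl_M \<epsilon> \<gamma> \<mu> \<nu> (\<psi> x)))
                  (\<lambda>y. cgl_Rl (cgl_B D \<beta>) (cgl_M \<epsilon> \<gamma> \<mu> \<nu> (\<psi> y)))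
                  (cgl_Ainf (cgl_B D \<beta>) (rotm \<delta> \<alpha>) lam))"
proof -
  obtain C \<eta> where decay': "\<eta> > 0" "\<And>x. norm (\<psi> x) \<le> C * exp (- \<eta> * \<bar>x\<bar>)"
      "\<And>x. norm (\<psi>' x) \<le> C * exp (- \<eta> * \<bar>x\<bar>)"
    using decay by blast
  obtain P :: "bool \<times> bool \<Rightarrow> complex^idx4^idx4" and f where P: "spectral_resolution P"
    "cgl_Ainf (cgl_B D \<beta>) (rotm \<delta> \<alpha>) lam = spectral_resolution.calculus P f" "\<And>i. Re (f i) \<noteq> 0"
    by (rule cgl_Ainf_resolution[OF Dbeta lam]) (rule that; assumption)
  show ?thesis
    unfolding P(2)
    by (rule spectral_resolution_4.lipschitz_cgl_K[OF spectral_resolution_4.intro[OF P(1)] P(3) cgl_Rr_mult_cgl_Rl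
          cgl_R_pulse[OF d1 decay' detM]])
qed

end
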